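(* Let $A$ and $B$ be two initial (extended) simple processes. Then $A\approx B$ if and only if $A\approx_c B$, where $\approx$ is trace equivalence for the concrete semantics and $\approx_c$ is trace equivalence for the compressed semantics.
   Context: **Terms and processes.** Fix pairwise disjoint infinite sets $\mathcal X$ (first-order variables), $\mathcal W$ (handles), a set $\mathcal N$ of names, a finite signature $\Sigma$ (constants allowed) and an equational theory $\mathsf E$ with induced congruence $=_{\mathsf E}$ on terms. $\mathcal T(S)$ is the set of terms built from $S$ using $\Sigma$; messages are in $\mathcal T(\mathcal N\cup\mathcal X)$, recipes in $\mathcal T(\mathcal W)$; ground means in $\mathcal T(\mathcal N)$. Fix a set $\mathcal C$ of channels. Basic processes on $c\in\mathcal C$: $P,Q::=0\mid \mathtt{if}\ u=v\ \mathtt{then}\ P\ \mathtt{else}\ Q\mid \mathtt{in}(c,x).P\mid \mathtt{out}(c,u).P$ with $u,v$ messages and $x\in\mathcal X$ (bound by the input); all actions are on the same channel $c$. A simple process $\mathcal P$ is a multiset of basic processes on pairwise distinct channels, null processes being removed. A frame $\Phi$ is a substitution with $\mathrm{dom}(\Phi)\subseteq\mathcal W$ and image in $\mathcal T(\mathcal N\cup\mathcal X)$, written $\{w\triangleright u,\dots\}$. An extended simple (resp. basic) process is a pair $(\mathcal P;\Phi)$ of a simple (resp. basic) process and a frame. All extended processes are closed: no free variables in $\mathcal P$, ground image of $\Phi$. $(\mathcal P;\Phi)$ is *initial* if every $P\in\mathcal P$ is of the form $\mathtt{in}(c,x).P'$. **Concrete semantics.** $(\{\mathtt{if}\ u=v\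 \mathtt{then}\ Q_1\ \mathtt{else}\ Q_2\}\uplus\mathcal P;\Phi)\xrightarrow{\tau}(\{Q_i\}\uplus\mathcal P;\Phi)$ with $i=1$ if $u=_{\mathsf E}v$, $i=2$ if $u\neq_{\mathsf E}v$; $(\{\mathtt{in}(c,x).Q\}\uplus\mathcal P;\Phi)\xrightarrow{\mathtt{in}(c,M)}(\{Q\{x\mapsto M\Phi\}\}\uplus\mathcal P;\Phi)$ for $M\in\mathcal T(\mathrm{dom}(\Phi))$; $(\{\mathtt{out}(c,u).Q\}\uplus\mathcal P;\Phi)\xrightarrow{\mathtt{out}(c,w)}(\{Q\}\uplus\mathcal P;\Phi\cup\{w\triangleright u\})$ for $w\in\mathcal W$ fresh. $A\stackrel{\mathrm{tr}}{\Rightarrow}B$ means $A\xrightarrow{a_1\cdots a_k}B$ for some $a_1\cdots a_k$ ($k\ge0$) that yields $\mathrm{tr}$ after erasing all $\tau$. **Compressed semantics.** Focused relations $\xrightarrow{\mathrm{tr}}_\ell$, $\ell\in\{i^+,i^*,o^*\}$, between extended basic processes $K,K',K''$ are the least with: (In) $K\xrightarrow{\mathtt{in}(c,M)}K'$ and $K'\xrightarrow{\mathrm{tr}}_{i^*}K''$ give $K\xrightarrow{\mathtt{in}(c,M)\cdot\mathrm{tr}}_\ell K''$ for $\ell\in\{i^*,i^+\}$; (Out) $K\xrightarrow{\mathtt{out}(c,w)}K'$ and $K'\xrightarrow{\mathrm{tr}}_{o^*}K''$ give $K\xrightarrow{\mathtt{out}(c,w)\cdot\mathrm{tr}}_\ell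 K''$ for $\ell\in\{i^*,o^*\}$; (Tau) $K\xrightarrow{\tau}K'$ and $K'\xrightarrow{\mathrm{tr}}_\ell K''$ give $K\xrightarrow{\mathrm{tr}}_\ell K''$ for any $\ell$; (Proper) $(P;\Phi)\xrightarrow{\epsilon}_{o^*}(P;\Phi)$ if $P=0$ or $P=\mathtt{in}(c,x).P'$; (Improper) $(0;\Phi)\xrightarrow{\epsilon}_{i^*}(\bot;\Phi)$, $\bot$ a special symbol. The compressed relation $\xrightarrow{}_{\mathrm c}$ is the least reflexive (label $\epsilon$) transitive (labels concatenate) relation on extended simple processes such that if $(Q;\Phi)\xrightarrow{\mathrm{tr}}_{i^+}(Q';\Phi')$ then $(\{Q\}\uplus\mathcal P;\Phi)\xrightarrow{\mathrm{tr}}_{\mathrm c}(\{Q'\}\uplus\mathcal P;\Phi')$ when $Q'\neq\bot$, and $(\{Q\}\uplus\mathcal P;\Phi)\xrightarrow{\mathrm{tr}}_{\mathrm c}(\varnothing;\Phi')$ when $Q'=\bot$. **Equivalences.** $\Phi\sim\Phi'$ (static equivalence) iff $\mathrm{dom}(\Phi)=\mathrm{dom}(\Phi')$ and for all $M,N\in\mathcal T(\mathrm{dom}(\Phi))$: $M\Phi=_{\mathsf E}N\Phi\Leftrightarrow M\Phi'=_{\mathsf E}N\Phi'$. $A\sqsubseteq B$ iff whenever $A\stackrel{\mathrm{tr}}{\Rightarrow}(\mathcal P;\Phi)$ there is $(\mathcal P';\Phi')$ with $B\stackrel{\mathrm{tr}}{\Rightarrow}(\mathcal P';\Phi')$ and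 $\Phi\sim\Phi'$; $A\approx B$ iff $A\sqsubseteq B$ and $B\sqsubseteq A$. $\sqsubseteq_c$ and $\approx_c$ are defined identically with $\xrightarrow{\mathrm{tr}}_{\mathrm c}$ in place of $\stackrel{\mathrm{tr}}{\Rightarrow}$. *)

theory Defs
  imports Main "HOL-Library.Multiset"
begin

section \<open>Terms\<close>

datatype (symbols: 'f, atoms: 'v) trm = Atom 'v | Fun 'f "('f, 'v) trm list"

primrec subst :: "('v \<Rightarrow> ('f, 'u) trm) \<Rightarrow> ('f, 'v) trm \<Rightarrow> ('f, 'u) trm" where
  "subst \<sigma> (Atom a) = \<sigma> a"
| "subst \<sigma> (Fun f ts) = Fun f (map (subst \<sigma>) ts)"

text \<open>A signature is a set of function symbols paired with their arities, so that the empty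
  signature is covered; constants have arity 0.\<close>

inductive_set terms :: "('f \<times> nat) set \<Rightarrow> 'v set \<Rightarrow> ('f, 'v) trm set"
  for Sig :: "('f \<times> nat) set" and S :: "'v set" where
  "a \<in> S \<Longrightarrow> Atom a \<in> terms Sig S"
| "(f, length ts) \<in> Sig \<Longrightarrow> (\<And>t. t \<in> set ts \<Longrightarrow> t \<in> terms Sig S) \<Longrightarrow> Fun f ts \<in> terms Sig S"

text \<open>Names, first-order variables, handles and channels are the types \<open>'n\<close>, \<open>'x\<close>, \<open>'w\<close>
  and \<open>'c\<close>.\<close>

datatype ('n, 'x) atom = Name 'n | Var 'x

type_synonym ('f, 'n, 'x) msg = "('f, ('n, 'x) atom) trm"

type_synonym ('f, 'w) recipe = "('f, 'w) trm"

abbreviation messages :: "('f \<times> nat) set \<Rightarrow> ('f, 'n, 'x) msg set" where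
  "messages Sig \<equiv> terms Sig UNIV"

abbreviation ground_messages :: "('f \<times> nat) set \<Rightarrow> ('f, 'n, 'x) msg set" where
  "ground_messages Sig \<equiv> terms Sig (range Name)"

definition msg_vars :: "('f, 'n, 'x) msg \<Rightarrow> 'x set" where
  "msg_vars u = {x. Var x \<in> atoms u}"

definition msg_subst :: "('x \<Rightarrow> ('f, 'n, 'x) msg) \<Rightarrow> ('f, 'n, 'x) msg \<Rightarrow> ('f, 'n, 'x) msg" where
  "msg_subst \<sigma> = subst (\<lambda>a. case a of Name n \<Rightarrow> Atom (Name n) | Var x \<Rightarrow> \<sigma> x)"

inductive eq_mod :: "('f \<times> nat) set \<Rightarrow> (('f, 'n, 'x) msg \<times> ('f, 'n, 'x) msg) set
    \<Rightarrow> ('f, 'n, 'x) msg \<Rightarrow> ('f, 'n, 'x) msg \<Rightarrow> bool"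
  for Sig :: "('f \<times> nat) set" and E :: "(('f, 'n, 'x) msg \<times> ('f, 'n, 'x) msg) set" where
  eq_ax: "(u, v) \<in> E \<Longrightarrow> (\<And>x. \<sigma> x \<in> messages Sig) \<Longrightarrow>
    eq_mod Sig E (msg_subst \<sigma> u) (msg_subst \<sigma> v)"
| eq_refl: "u \<in> messages Sig \<Longrightarrow> eq_mod Sig E u u"
| eq_sym: "eq_mod Sig E u v \<Longrightarrow> eq_mod Sig E v u"
| eq_trans: "eq_mod Sig E u v \<Longrightarrow> eq_mod Sig E v w \<Longrightarrow> eq_mod Sig E u w"
| eq_cong: "(f, length us) \<in> Sig \<Longrightarrow> list_all2 (eq_mod Sig E) us vs \<Longrightarrow>
    eq_mod Sig E (Fun f us) (Fun f vs)"

section \<open>Processes\<close>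

datatype ('f, 'n, 'x, 'c) proc =
    Null
  | Cond "('f, 'n, 'x) msg" "('f, 'n, 'x) msg" "('f, 'n, 'x, 'c) proc" "('f, 'n, 'x, 'c) proc"
  | Inp 'c 'x "('f, 'n, 'x, 'c) proc"
  | Outp 'c "('f, 'n, 'x) msg" "('f, 'n, 'x, 'c) proc"

primrec basic_on :: "('f \<times> nat) set \<Rightarrow> 'c \<Rightarrow> ('f, 'n, 'x, 'c) proc \<Rightarrow> bool" where
  "basic_on Sig c Null \<longleftrightarrow> True"
| "basic_on Sig c (Cond u v P Q) \<longleftrightarrow>
    u \<in> messages Sig \<and> v \<in> messages Sig \<and> basic_on Sig c P \<and> basic_on Sig c Q"
| "basic_on Sig c (Inp d x P) \<longleftrightarrow> d = c \<and> basic_on Sig c P"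
| "basic_on Sig c (Outp d u P) \<longleftrightarrow> d = c \<and> u \<in> messages Sig \<and> basic_on Sig c P"

primrec free_vars :: "('f, 'n, 'x, 'c) proc \<Rightarrow> 'x set" where
  "free_vars Null = {}"
| "free_vars (Cond u v P Q) = msg_vars u \<union> msg_vars v \<union> free_vars P \<union> free_vars Q"
| "free_vars (Inp c x P) = free_vars P - {x}"
| "free_vars (Outp c u P) = msg_vars u \<union> free_vars P"

text \<open>Renaming of bound variables is not needed below, since only ground messages are
  substituted into processes.\<close>

primrec proc_subst :: "'x \<Rightarrow> ('f, 'n, 'x) msg \<Rightarrow> ('f, 'n, 'x, 'c) proc \<Rightarrow> ('f, 'n, 'x, 'c) proc"
  where
  "proc_subst x t Null = Null"
| "proc_subst x t (Cond u v P Q) =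
    Cond (msg_subst ((Atom \<circ> Var)(x := t)) u) (msg_subst ((Atom \<circ> Var)(x := t)) v)
      (proc_subst x t P) (proc_subst x t Q)"
| "proc_subst x t (Inp c y P) = Inp c y (if y = x then P else proc_subst x t P)"
| "proc_subst x t (Outp c u P) = Outp c (msg_subst ((Atom \<circ> Var)(x := t)) u) (proc_subst x t P)"

text \<open>The channels are existentially quantified because a basic process without any input or
  output, such as a conditional with null branches, is on every channel.\<close>

definition simple :: "('f \<times> nat) set \<Rightarrow> ('f, 'n, 'x, 'c) proc multiset \<Rightarrow> bool" where
  "simple Sig \<P> \<longleftrightarrow> Null \<notin># \<P> \<and>
    (\<exists>Ps cs. \<P> = mset Ps \<and> distinct cs \<and> list_all2 (basic_on Sig) cs Ps)"

definition add_proc ::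
    "('f, 'n, 'x, 'c) proc \<Rightarrow> ('f, 'n, 'x, 'c) proc multiset \<Rightarrow> ('f, 'n, 'x, 'c) proc multiset" where
  "add_proc P \<P> = (if P = Null then \<P> else add_mset P \<P>)"

type_synonym ('f, 'n, 'x, 'w) frame = "'w \<rightharpoonup> ('f, 'n, 'x) msg"

definition apply_frame :: "('f, 'n, 'x, 'w) frame \<Rightarrow> ('f, 'w) recipe \<Rightarrow> ('f, 'n, 'x) msg" where
  "apply_frame \<Phi> M = subst (\<lambda>w. the (\<Phi> w)) M"

type_synonym ('f, 'n, 'x, 'c, 'w) ext_basic =
  "('f, 'n, 'x, 'c) proc \<times> ('f, 'n, 'x, 'w) frame"

type_synonym ('f, 'n, 'x, 'c, 'w) ext_simple =
  "('f, 'n, 'x, 'c) proc multiset \<times> ('f, 'n, 'x, 'w) frame"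

definition ext_simple_process :: "('f \<times> nat) set \<Rightarrow> ('f, 'n, 'x, 'c, 'w) ext_simple \<Rightarrow> bool" where
  "ext_simple_process Sig A \<longleftrightarrow> (case A of (\<P>, \<Phi>) \<Rightarrow>
    simple Sig \<P> \<and> (\<forall>P \<in># \<P>. free_vars P = {}) \<and>
    finite (dom \<Phi>) \<and> ran \<Phi> \<subseteq> ground_messages Sig)"

definition initial :: "('f, 'n, 'x, 'c, 'w) ext_simple \<Rightarrow> bool" where
  "initial A \<longleftrightarrow> (\<forall>P \<in># fst A. \<exists>c x P'. P = Inp c x P')"

section \<open>Concrete semantics\<close>

datatype ('f, 'c, 'w) action = Tau | AIn 'c "('f, 'w) recipe" | AOut 'c 'w

text \<open>All rules of the concrete semantics rewrite a single basic process and possibly extend the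
  frame, so they are given on extended basic processes and lifted to simple ones.\<close>

inductive basic_step :: "('f \<times> nat) set \<Rightarrow> (('f, 'n, 'x) msg \<times> ('f, 'n, 'x) msg) set \<Rightarrow>
    ('f, 'n, 'x, 'c, 'w) ext_basic \<Rightarrow> ('f, 'c, 'w) action \<Rightarrow> ('f, 'n, 'x, 'c, 'w) ext_basic \<Rightarrow> bool"
  for Sig :: "('f \<times> nat) set" and E :: "(('f, 'n, 'x) msg \<times> ('f, 'n, 'x) msg) set" where
  step_then: "eq_mod Sig E u v \<Longrightarrow> basic_step Sig E (Cond u v P Q, \<Phi>) Tau (P, \<Phi>)"
| step_else: "\<not> eq_mod Sig E u v \<Longrightarrow> basic_step Sig E (Cond u v P Q, \<Phi>) Tau (Q, \<Phi>)"
| step_in: "M \<in> terms Sig (dom \<Phi>) \<Longrightarrow>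
    basic_step Sig E (Inp c x P, \<Phi>) (AIn c M) (proc_subst x (apply_frame \<Phi> M) P, \<Phi>)"
| step_out: "w \<notin> dom \<Phi> \<Longrightarrow> basic_step Sig E (Outp c u P, \<Phi>) (AOut c w) (P, \<Phi>(w \<mapsto> u))"

inductive step :: "('f \<times> nat) set \<Rightarrow> (('f, 'n, 'x) msg \<times> ('f, 'n, 'x) msg) set \<Rightarrow>
    ('f, 'n, 'x, 'c, 'w) ext_simple \<Rightarrow> ('f, 'c, 'w) action \<Rightarrow> ('f, 'n, 'x, 'c, 'w) ext_simple \<Rightarrow> bool"
  for Sig :: "('f \<times> nat) set" and E :: "(('f, 'n, 'x) msg \<times> ('f, 'n, 'x) msg) set" where
  "basic_step Sig E (P, \<Phi>) a (P', \<Phi>') \<Longrightarrow>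
    step Sig E (add_mset P \<P>, \<Phi>) a (add_proc P' \<P>, \<Phi>')"

inductive steps :: "('f \<times> nat) set \<Rightarrow> (('f, 'n, 'x) msg \<times> ('f, 'n, 'x) msg) set \<Rightarrow>
    ('f, 'n, 'x, 'c, 'w) ext_simple \<Rightarrow> ('f, 'c, 'w) action list \<Rightarrow>
    ('f, 'n, 'x, 'c, 'w) ext_simple \<Rightarrow> bool"
  for Sig :: "('f \<times> nat) set" and E :: "(('f, 'n, 'x) msg \<times> ('f, 'n, 'x) msg) set" where
  steps_Nil: "steps Sig E A [] A"
| steps_Cons: "step Sig E A a B \<Longrightarrow> steps Sig E B as C \<Longrightarrow> steps Sig E A (a # as) C"

definition weak_steps :: "('f \<times> nat) set \<Rightarrow> (('f, 'n, 'x) msg \<times> ('f, 'n, 'x) msg) set \<Rightarrow>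
    ('f, 'n, 'x, 'c, 'w) ext_simple \<Rightarrow> ('f, 'c, 'w) action list \<Rightarrow>
    ('f, 'n, 'x, 'c, 'w) ext_simple \<Rightarrow> bool" where
  "weak_steps Sig E A tr B \<longleftrightarrow> (\<exists>as. steps Sig E A as B \<and> filter (\<lambda>a. a \<noteq> Tau) as = tr)"

section \<open>Compressed semantics\<close>

datatype mode = IPlus | IStar | OStar

text \<open>In the target of the focused relations, \<open>None\<close> stands for the symbol \<open>\<bottom>\<close>.\<close>

inductive focused :: "('f \<times> nat) set \<Rightarrow> (('f, 'n, 'x) msg \<times> ('f, 'n, 'x) msg) set \<Rightarrow> mode \<Rightarrow>
    ('f, 'n, 'x, 'c, 'w) ext_basic \<Rightarrow> ('f, 'c, 'w) action list \<Rightarrow>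
    ('f, 'n, 'x, 'c) proc option \<times> ('f, 'n, 'x, 'w) frame \<Rightarrow> bool"
  for Sig :: "('f \<times> nat) set" and E :: "(('f, 'n, 'x) msg \<times> ('f, 'n, 'x) msg) set" where
  foc_in: "basic_step Sig E K (AIn c M) K' \<Longrightarrow> focused Sig E IStar K' tr K'' \<Longrightarrow>
    l \<in> {IStar, IPlus} \<Longrightarrow> focused Sig E l K (AIn c M # tr) K''"
| foc_out: "basic_step Sig E K (AOut c w) K' \<Longrightarrow> focused Sig E OStar K' tr K'' \<Longrightarrow>
    l \<in> {IStar, OStar} \<Longrightarrow> focused Sig E l K (AOut c w # tr) K''"
| foc_tau: "basic_step Sig E K Tau K' \<Longrightarrow> focused Sig E l K' tr K'' \<Longrightarrow> focused Sig E l K tr K''"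
| foc_proper: "P = Null \<or> (\<exists>c x P'. P = Inp c x P') \<Longrightarrow>
    focused Sig E OStar (P, \<Phi>) [] (Some P, \<Phi>)"
| foc_improper: "focused Sig E IStar (Null, \<Phi>) [] (None, \<Phi>)"

inductive compressed :: "('f \<times> nat) set \<Rightarrow> (('f, 'n, 'x) msg \<times> ('f, 'n, 'x) msg) set \<Rightarrow>
    ('f, 'n, 'x, 'c, 'w) ext_simple \<Rightarrow> ('f, 'c, 'w) action list \<Rightarrow>
    ('f, 'n, 'x, 'c, 'w) ext_simple \<Rightarrow> bool"
  for Sig :: "('f \<times> nat) set" and E :: "(('f, 'n, 'x) msg \<times> ('f, 'n, 'x) msg) set" where
  comp_refl: "compressed Sig E A [] A"
| comp_trans: "compressed Sig E A tr B \<Longrightarrow> compressed Sig E B tr' C \<Longrightarrow>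
    compressed Sig E A (tr @ tr') C"
| comp_proper: "focused Sig E IPlus (Q, \<Phi>) tr (Some Q', \<Phi>') \<Longrightarrow>
    compressed Sig E (add_mset Q \<P>, \<Phi>) tr (add_proc Q' \<P>, \<Phi>')"
| comp_improper: "focused Sig E IPlus (Q, \<Phi>) tr (None, \<Phi>') \<Longrightarrow>
    compressed Sig E (add_mset Q \<P>, \<Phi>) tr ({#}, \<Phi>')"

section \<open>Equivalences\<close>

definition static_equiv :: "('f \<times> nat) set \<Rightarrow> (('f, 'n, 'x) msg \<times> ('f, 'n, 'x) msg) set \<Rightarrow>
    ('f, 'n, 'x, 'w) frame \<Rightarrow> ('f, 'n, 'x, 'w) frame \<Rightarrow> bool" where
  "static_equiv Sig E \<Phi> \<Phi>' \<longleftrightarrow> dom \<Phi> = dom \<Phi>' \<and>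
    (\<forall>M \<in> terms Sig (dom \<Phi>). \<forall>N \<in> terms Sig (dom \<Phi>).
      eq_mod Sig E (apply_frame \<Phi> M) (apply_frame \<Phi> N) \<longleftrightarrow>
      eq_mod Sig E (apply_frame \<Phi>' M) (apply_frame \<Phi>' N))"

definition trace_incl :: "('f \<times> nat) set \<Rightarrow> (('f, 'n, 'x) msg \<times> ('f, 'n, 'x) msg) set \<Rightarrow>
    ('f, 'n, 'x, 'c, 'w) ext_simple \<Rightarrow> ('f, 'n, 'x, 'c, 'w) ext_simple \<Rightarrow> bool" where
  "trace_incl Sig E A B \<longleftrightarrow> (\<forall>tr \<P> \<Phi>. weak_steps Sig E A tr (\<P>, \<Phi>) \<longrightarrow>
    (\<exists>\<P>' \<Phi>'. weak_steps Sig E B tr (\<P>', \<Phi>') \<and> static_equiv Sig E \<Phi> \<Phi>'))"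

definition trace_equiv :: "('f \<times> nat) set \<Rightarrow> (('f, 'n, 'x) msg \<times> ('f, 'n, 'x) msg) set \<Rightarrow>
    ('f, 'n, 'x, 'c, 'w) ext_simple \<Rightarrow> ('f, 'n, 'x, 'c, 'w) ext_simple \<Rightarrow> bool" where
  "trace_equiv Sig E A B \<longleftrightarrow> trace_incl Sig E A B \<and> trace_incl Sig E B A"

definition comp_trace_incl :: "('f \<times> nat) set \<Rightarrow> (('f, 'n, 'x) msg \<times> ('f, 'n, 'x) msg) set \<Rightarrow>
    ('f, 'n, 'x, 'c, 'w) ext_simple \<Rightarrow> ('f, 'n, 'x, 'c, 'w) ext_simple \<Rightarrow> bool" where
  "comp_trace_incl Sig E A B \<longleftrightarrow> (\<forall>tr \<P> \<Phi>. compressed Sig E A tr (\<P>, \<Phi>) \<longrightarrow>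
    (\<exists>\<P>' \<Phi>'. compressed Sig E B tr (\<P>', \<Phi>') \<and> static_equiv Sig E \<Phi> \<Phi>'))"

definition comp_trace_equiv :: "('f \<times> nat) set \<Rightarrow> (('f, 'n, 'x) msg \<times> ('f, 'n, 'x) msg) set \<Rightarrow>
    ('f, 'n, 'x, 'c, 'w) ext_simple \<Rightarrow> ('f, 'n, 'x, 'c, 'w) ext_simple \<Rightarrow> bool" where
  "comp_trace_equiv Sig E A B \<longleftrightarrow> comp_trace_incl Sig E A B \<and> comp_trace_incl Sig E B A"

end

theory Submission imports Defs begin

text \<open>The obstacle to reordering is the frame: an input may use handles that were output on
  other channels. But frames only grow, so each recipe can be evaluated in the final frame instead
  of the current one. All dependence between channels then shrinks to a condition on the trace
  alone: recipes use available handles and output handles are fresh.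

  Continuing or testing a process at an input requires a recipe, and none need exist without
  constants and handles. Hence this is done only on channels that already performed an input, whose
  recipe is reused; untouched channels are left alone. Prolonging does no harm because static
  equivalence restricts to smaller frames.

  The two directions are not symmetric. An inclusion of compressed traces yields the concrete
  inclusion in the same direction. Matching a compressed trace uses both concrete inclusions at
  once: one to follow the block, the reverse one to show that the matching process has stopped where
  the block ends.\<close>

text \<open>
  The channels of a simple process identify its components, so, once conditionals are resolved, an
  execution is determined by its trace. It is moreover determined by the projections of the trace to the
  channels: an input may be delayed and an output anticipated past actions on other channels.

  If \<open>A \<approx> B\<close>, then \<open>B\<close> can follow a block of \<open>A\<close>, and it must be at a block boundary afterwards, since any
  further action that it could perform within the block would have to be possible for \<open>A\<close>.
  Conversely, an execution of \<open>A\<close> is first prolonged until each active channel has completed a proper block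
  or terminated. Then the block of the first output can be moved to the front; iterating this
  leaves one improper block per remaining channel. These cannot be executed one after the other in
  the compressed semantics, but do not extend the frame, so \<open>B\<close> can match them separately.
\<close>

section \<open>Families of processes indexed by channels\<close>

text \<open>The channel discipline extracted from \<open>basic_on\<close>; it identifies the
  component that performs a given action.\<close>

primrec on_channel :: "'c \<Rightarrow> ('f, 'n, 'x, 'c) proc \<Rightarrow> bool" where
  "on_channel c Null \<longleftrightarrow> True"
| "on_channel c (Cond u v P Q) \<longleftrightarrow> on_channel c P \<and> on_channel c Q"
| "on_channel c (Inp d x P) \<longleftrightarrow> d = c \<and> on_channel c P"
| "on_channel c (Outp d u P) \<longleftrightarrow> d = c \<and> on_channel c P"

text \<open>Termination measure for prolonging executions: it is stable under substitution, and the
  sum over both branches bounds whichever branch a conditional takes.\<close>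

primrec num_actions :: "('f, 'n, 'x, 'c) proc \<Rightarrow> nat" where
  "num_actions Null = 0"
| "num_actions (Cond u v P Q) = num_actions P + num_actions Q"
| "num_actions (Inp d x P) = Suc (num_actions P)"
| "num_actions (Outp d u P) = Suc (num_actions P)"

lemma basic_on_on_channel: "basic_on Sig c P \<Longrightarrow> on_channel c P"
  by (induction P) auto

lemma on_channel_proc_subst: "on_channel c P \<Longrightarrow> on_channel c (proc_subst x t P)"
  by (induction P) auto

lemma num_actions_proc_subst [simp]: "num_actions (proc_subst x t P) = num_actions P"
  by (induction P) auto

definition family :: "('c \<Rightarrow> ('f, 'n, 'x, 'c) proc) \<Rightarrow> bool" where
  "family f \<longleftrightarrow> finite {c. f c \<noteq> Null} \<and> (\<forall>c. on_channel c (f c))"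

definition mset_of :: "('c \<Rightarrow> ('f, 'n, 'x, 'c) proc) \<Rightarrow> ('f, 'n, 'x, 'c) proc multiset" where
  "mset_of f = image_mset f (mset_set {c. f c \<noteq> Null})"

lemma family_on_channel: "family f \<Longrightarrow> on_channel c (f c)"
  by (simp add: family_def)

lemma family_upd: "family f \<Longrightarrow> on_channel c P \<Longrightarrow> family (f(c := P))"
  unfolding family_def
  by (auto intro: finite_subset[of _ "insert c {c. f c \<noteq> Null}"])

lemma add_proc_mset_of:
  assumes "family f"
  shows "add_proc P (mset_of (f(c := Null))) = mset_of (f(c := P))"
proof (cases "P = Null")
  case False
  have "finite {d. f d \<noteq> Null \<and> d \<noteq> c}"
    using assms by (auto simp: family_def)
  moreover have "{d. (f(c := P)) d \<noteq> Null} = insert c {d. f d \<noteq> Null \<and> d \<noteq> c}"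
    "{d. (f(c := Null)) d \<noteq> Null} = {d. f d \<noteq> Null \<and> d \<noteq> c}"
    using False by auto
  ultimately show ?thesis
    using False by (auto simp: mset_of_def add_proc_def intro!: image_mset_cong)
qed (simp add: add_proc_def)

lemma mset_of_remove:
  assumes "family f" "f c \<noteq> Null"
  shows "mset_of f = add_mset (f c) (mset_of (f(c := Null)))"
  using add_proc_mset_of[OF assms(1), of "f c" c] assms(2) by (simp add: add_proc_def)

text \<open>Several channels may hold the same process, for instance a conditional without actions.
  Any of them will do, since removing either leaves the same multiset.\<close>

lemma mset_of_add_msetE:
  assumes "family f" "mset_of f = add_mset P \<P>"
  obtains c where "f c = P" "\<P> = mset_of (f(c := Null))"
proof -
  have "P \<in># mset_of f" using assms(2) by simp
  then obtain c where c: "f c = P" "P \<noteq> Null"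
    using assms(1) by (auto simp: mset_of_def family_def)
  then have "\<P> = mset_of (f(c := Null))"
    using mset_of_remove[OF assms(1), of c] assms(2) by simp
  with c that show ?thesis by blast
qed

lemma mset_of_empty [simp]: "mset_of (\<lambda>_. Null) = {#}"
  by (simp add: mset_of_def)

text \<open>Distinctness of the channels gives each list entry a place of its own. The last clause
  carries initiality over from the multiset to the family.\<close>

lemma simple_imp_family:
  assumes "simple Sig \<P>"
  obtains f where "family f" "\<P> = mset_of f" "\<And>c. f c = Null \<or> f c \<in># \<P>"
proof -
  have "\<exists>f. family f \<and> mset Ps = mset_of f \<and> (\<forall>c. f c = Null \<or> (c \<in> set cs \<and> f c \<in> set Ps))"
    if "list_all2 (basic_on Sig) cs Ps" "distinct cs" "Null \<notin> set Ps" for cs Ps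
    using that
  proof (induction rule: list_all2_induct)
    case Nil
    show ?case by (intro exI[of _ "\<lambda>_. Null"]) (simp add: family_def)
  next
    case (Cons c cs P Ps)
    then obtain f where f: "family f" "mset Ps = mset_of f"
      "\<forall>d. f d = Null \<or> (d \<in> set cs \<and> f d \<in> set Ps)" by auto
    have "f c = Null" using f(3) Cons.prems by auto
    then have "add_proc P (mset_of f) = mset_of (f(c := P))"
      using add_proc_mset_of[OF f(1), of P c] by (simp add: fun_upd_idem)
    then have "mset (P # Ps) = mset_of (f(c := P))"
      using f(2) Cons.prems by (auto simp: add_proc_def split: if_splits)
    moreover have "family (f(c := P))"
      using f(1) Cons.hyps(1) by (auto intro: family_upd basic_on_on_channel)
    moreover have "\<forall>d. (f(c := P)) d = Null \<or> (d \<in> set (c # cs) \<and> (f(c := P)) d \<in> set (P # Ps))"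
      using f(3) by auto
    ultimately show ?case by blast
  qed
  with assms that show ?thesis unfolding simple_def
    by (metis set_mset_mset)
qed

section \<open>Traces\<close>

primrec action_on :: "'c \<Rightarrow> ('f, 'c, 'w) action \<Rightarrow> bool" where
  "action_on c Tau \<longleftrightarrow> False"
| "action_on c (AIn d M) \<longleftrightarrow> d = c"
| "action_on c (AOut d w) \<longleftrightarrow> d = c"

abbreviation proj :: "'c \<Rightarrow> ('f, 'c, 'w) action list \<Rightarrow> ('f, 'c, 'w) action list" where
  "proj c \<equiv> filter (action_on c)"

definition outputs :: "('f, 'c, 'w) action list \<Rightarrow> 'w set" where
  "outputs tr = {w. \<exists>c. AOut c w \<in> set tr}"

text \<open>Collects the only demands of an execution that couple different channels;
  \<open>D\<close> holds the handles available so far.\<close>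

fun wf_trace :: "('f \<times> nat) set \<Rightarrow> 'w set \<Rightarrow> ('f, 'c, 'w) action list \<Rightarrow> bool" where
  "wf_trace Sig D [] \<longleftrightarrow> True"
| "wf_trace Sig D (Tau # tr) \<longleftrightarrow> False"
| "wf_trace Sig D (AIn c M # tr) \<longleftrightarrow> M \<in> terms Sig D \<and> wf_trace Sig D tr"
| "wf_trace Sig D (AOut c w # tr) \<longleftrightarrow> w \<notin> D \<and> wf_trace Sig (insert w D) tr"

definition inputs_on :: "'c \<Rightarrow> ('f, 'c, 'w) action list \<Rightarrow> bool" where
  "inputs_on c tr \<longleftrightarrow> (\<forall>a \<in> set tr. \<exists>M. a = AIn c M)"

definition outputs_on :: "'c \<Rightarrow> ('f, 'c, 'w) action list \<Rightarrow> bool" where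
  "outputs_on c tr \<longleftrightarrow> (\<forall>a \<in> set tr. \<exists>w. a = AOut c w)"

text \<open>The empty trace is included: in both cases a preceding run of outputs ends here.\<close>

definition starts_input :: "('f, 'c, 'w) action list \<Rightarrow> bool" where
  "starts_input tr \<longleftrightarrow> tr = [] \<or> (\<exists>c M as. tr = AIn c M # as)"

lemma inputs_on_simps [simp]:
  "inputs_on c []" "inputs_on c (a # tr) \<longleftrightarrow> (\<exists>M. a = AIn c M) \<and> inputs_on c tr"
  by (auto simp: inputs_on_def)

lemma outputs_on_simps [simp]:
  "outputs_on c []" "outputs_on c (a # tr) \<longleftrightarrow> (\<exists>w. a = AOut c w) \<and> outputs_on c tr"
  by (auto simp: outputs_on_def)

lemma outputs_simps [simp]:
  "outputs [] = {}" "outputs (AIn c M # tr) = outputs tr"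
  "outputs (AOut c w # tr) = insert w (outputs tr)"
  by (auto simp: outputs_def)

lemma starts_input_Nil [simp]: "starts_input []"
  by (simp add: starts_input_def)

lemma inputs_on_outputs [simp]: "inputs_on c tr \<Longrightarrow> outputs tr = {}"
  by (induction tr) auto

lemma proj_inputs_on: "inputs_on c tr \<Longrightarrow> proj d tr = (if d = c then tr else [])"
  by (induction tr) auto

lemma proj_outputs_on: "outputs_on c tr \<Longrightarrow> proj d tr = (if d = c then tr else [])"
  by (induction tr) auto

lemma action_on_unique: "action_on c a \<Longrightarrow> action_on d a \<Longrightarrow> c = d"
  by (cases a) auto

lemma proj_proj: "proj d (proj c tr) = (if d = c then proj c tr else [])"
  by (auto simp: filter_empty_conv dest: action_on_unique)

text \<open>The change from inputs to outputs and the next input or end of the trace mark the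
  borders, so \<open>takeWhile\<close> recovers both halves of the block. The two decompositions may
  name different channels.\<close>

lemma block_append_unique:
  fixes tr :: "('f, 'c, 'w) action list"
  assumes "inputs_on c ins" "outputs_on c outs" "outs \<noteq> []" "starts_input tr"
    and "inputs_on c' ins'" "outputs_on c' outs'" "outs' \<noteq> []" "starts_input tr'"
    and "ins @ outs @ tr = ins' @ outs' @ tr'"
  shows "ins = ins' \<and> outs = outs' \<and> tr = tr'"
proof -
  define is_in :: "('f, 'c, 'w) action \<Rightarrow> bool" where "is_in a \<longleftrightarrow> (\<exists>c M. a = AIn c M)" for a
  define is_out :: "('f, 'c, 'w) action \<Rightarrow> bool" where "is_out a \<longleftrightarrow> (\<exists>c w. a = AOut c w)" for a
  have ins: "takeWhile is_in (ins @ outs @ tr) = ins"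
    if "inputs_on c ins" "outputs_on c outs" "outs \<noteq> []" for ins outs tr c
    using that by (induction ins; cases outs) (auto simp: is_in_def)
  have outs: "takeWhile is_out (outs @ tr) = outs"
    if "outputs_on c outs" "starts_input tr" for outs tr c
    using that by (induction outs) (auto simp: is_out_def starts_input_def)
  have 1: "ins = ins'" using ins[OF assms(1-3), of tr] ins[OF assms(5-7), of tr'] assms(9) by simp
  then have "outs @ tr = outs' @ tr'" using assms by simp
  moreover from this have "outs = outs'" using outs[OF assms(2,4)] outs[OF assms(6,8)] by simp
  ultimately show ?thesis using 1 by simp
qed

section \<open>Moving outputs and blocks to the front of a trace\<close>

lemma terms_mono: "M \<in> terms Sig S \<Longrightarrow> S \<subseteq> T \<Longrightarrow> M \<in> terms Sig T"
  by (induction rule: terms.induct) (auto intro: terms.intros)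

lemma wf_trace_no_Tau: "wf_trace Sig D tr \<Longrightarrow> Tau \<notin> set tr"
  by (induction Sig D tr rule: wf_trace.induct) auto

lemma wf_trace_inputs_append:
  "\<forall>a \<in> set ins. \<exists>c M. a = AIn c M \<Longrightarrow>
    wf_trace Sig D (ins @ tr) \<longleftrightarrow> (\<forall>c M. AIn c M \<in> set ins \<longrightarrow> M \<in> terms Sig D) \<and> wf_trace Sig D tr"
  by (induction ins) auto

text \<open>An earlier output only enlarges the set of handles for an input, and two outputs carry
  distinct handles anyway. The converse exchange could deprive an input of a handle.\<close>

lemma wf_trace_output_first:
  "wf_trace Sig D (a # AOut c w # tr) \<Longrightarrow> wf_trace Sig D (AOut c w # a # tr)"
  by (cases a) (auto simp: insert_commute elim: terms_mono)

lemma wf_trace_outputs_before_action: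
  "outputs_on c outs \<Longrightarrow> wf_trace Sig D (a # outs @ tr) \<Longrightarrow> wf_trace Sig D (outs @ a # tr)"
proof (induction outs arbitrary: D)
  case (Cons b outs)
  then obtain w where b: "b = AOut c w" by auto
  then have "wf_trace Sig D (AOut c w # a # outs @ tr)"
    using Cons.prems wf_trace_output_first[of Sig D a c w "outs @ tr"] by simp
  then show ?case using b Cons by simp
qed simp

lemma wf_trace_Cons_cong:
  "(\<And>D. wf_trace Sig D tr \<Longrightarrow> wf_trace Sig D tr') \<Longrightarrow>
    wf_trace Sig D (a # tr) \<Longrightarrow> wf_trace Sig D (a # tr')"
  by (cases a) auto

lemma wf_trace_outputs_first:
  "outputs_on c outs \<Longrightarrow> wf_trace Sig D (as @ outs @ tr) \<Longrightarrow> wf_trace Sig D (outs @ as @ tr)"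
proof (induction as arbitrary: D)
  case (Cons a as)
  have "wf_trace Sig D (a # outs @ as @ tr)"
    using wf_trace_Cons_cong[of Sig "as @ outs @ tr" "outs @ as @ tr" D a] Cons by auto
  then show ?case
    using wf_trace_outputs_before_action[OF Cons.prems(1), of Sig D a "as @ tr"] by simp
qed simp

text \<open>\<open>outs\<close> collects the outputs on \<open>c\<close> before its next input. They
  overtake actions of other channels only, so projections survive. Quantifying over \<open>D\<close>
  permits a use behind an output, where the handles have changed.\<close>

lemma extract_outputs:
  obtains outs rest where "outputs_on c outs" "mset tr = mset (outs @ rest)"
    "\<And>d. proj d tr = proj d (outs @ rest)" "starts_input (proj c rest)"
    "\<And>D. wf_trace Sig D tr \<Longrightarrow> wf_trace Sig D (outs @ rest)"
proof -
  have "\<exists>outs rest. outputs_on c outs \<and> mset tr = mset (outs @ rest) \<and>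
    (\<forall>d. proj d tr = proj d (outs @ rest)) \<and> starts_input (proj c rest) \<and>
    (\<forall>D. wf_trace Sig D tr \<longrightarrow> wf_trace Sig D (outs @ rest))"
  proof (induction tr)
    case Nil
    show ?case by (intro exI[of _ "[]"]) (auto simp: starts_input_def)
  next
    case (Cons a tr)
    then obtain outs rest where IH: "outputs_on c outs" "mset tr = mset (outs @ rest)"
      "\<And>d. proj d tr = proj d (outs @ rest)" "starts_input (proj c rest)"
      "\<And>D. wf_trace Sig D tr \<Longrightarrow> wf_trace Sig D (outs @ rest)" by auto
    have wf: "wf_trace Sig D (a # outs @ rest)" if "wf_trace Sig D (a # tr)" for D
      using that IH(5) by (blast intro: wf_trace_Cons_cong)
    consider "\<exists>w. a = AOut c w" | "\<exists>M. a = AIn c M" | "\<not> action_on c a"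
      by (cases a) auto
    then show ?case
    proof cases
      case 1
      then show ?thesis using IH wf
        by (intro exI[of _ "a # outs"] exI[of _ rest]) auto
    next
      case 2
      then show ?thesis
        by (intro exI[of _ "[]"] exI[of _ "a # tr"]) (auto simp: starts_input_def)
    next
      case 3
      have "proj d (a # tr) = proj d (outs @ a # rest)" for d
        using 3 IH(3)[of d] proj_outputs_on[OF IH(1), of d] by auto
      moreover have "wf_trace Sig D (outs @ a # rest)" if "wf_trace Sig D (a # tr)" for D
        using wf[OF that] wf_trace_outputs_before_action[OF IH(1)] by blast
      ultimately show ?thesis using 3 IH
        by (intro exI[of _ outs] exI[of _ "a # rest"]) auto
    qed
  qed
  then show ?thesis using that by blast
qed

text \<open>The block is the one containing the first output of the trace: its inputs precede every output,
  hence their recipes only use the initial handles and the block can be moved to the front.\<close>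

lemma extract_block:
  fixes tr :: "('f, 'c, 'w) action list"
  assumes "wf_trace Sig D tr" "outputs tr \<noteq> {}"
  obtains c ins outs rest where "inputs_on c ins" "outputs_on c outs" "outs \<noteq> []"
    "mset tr = mset ((ins @ outs) @ rest)" "\<And>d. proj d tr = proj d ((ins @ outs) @ rest)"
    "starts_input (proj c rest)" "wf_trace Sig D ((ins @ outs) @ rest)"
proof -
  define is_out :: "('f, 'c, 'w) action \<Rightarrow> bool" where "is_out a \<longleftrightarrow> (\<exists>c w. a = AOut c w)" for a
  have "\<exists>a \<in> set tr. is_out a" using assms(2) by (auto simp: outputs_def is_out_def)
  then obtain pre c w post where tr: "tr = pre @ AOut c w # post" "\<forall>a \<in> set pre. \<not> is_out a"
    using split_list_first_prop[of tr is_out] unfolding is_out_def by blast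
  have ins: "\<forall>a \<in> set pre. \<exists>c M. a = AIn c M"
  proof
    fix a assume "a \<in> set pre"
    then show "\<exists>c M. a = AIn c M"
      using tr wf_trace_no_Tau[OF assms(1)] by - (rule action.exhaust[of a], auto simp: is_out_def)
  qed
  obtain outs rest where or: "outputs_on c outs" "mset post = mset (outs @ rest)"
    "\<And>d. proj d post = proj d (outs @ rest)" "starts_input (proj c rest)"
    "\<And>D. wf_trace Sig D post \<Longrightarrow> wf_trace Sig D (outs @ rest)"
    using extract_outputs[of c post Sig] by blast
  \<comment> \<open>The inputs before the first output that belong to other channels; they go behind
    the block, since outputs may overtake inputs.\<close>
  define other where "other = filter (\<lambda>a. \<not> action_on c a) pre"
  have proj_other: "proj d other = (if d = c then [] else proj d pre)" for d
    unfolding other_def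
    by (auto simp: filter_empty_conv intro!: filter_cong dest: action_on_unique)
  have on: "outputs_on c (AOut c w # outs)" using or(1) by simp
  have wf: "wf_trace Sig D (AOut c w # post)" and
    pre: "\<forall>c M. AIn c M \<in> set pre \<longrightarrow> M \<in> terms Sig D"
    using assms(1) wf_trace_inputs_append[OF ins] unfolding tr(1) by auto
  have "wf_trace Sig D ((AOut c w # outs) @ rest)"
    using wf_trace_Cons_cong[OF or(5) wf] by simp
  then have "wf_trace Sig D (other @ (AOut c w # outs) @ rest)"
    using ins pre by (subst wf_trace_inputs_append) (auto simp: other_def)
  then have "wf_trace Sig D ((AOut c w # outs) @ other @ rest)"
    by (rule wf_trace_outputs_first[OF on])
  then have "wf_trace Sig D (proj c pre @ (AOut c w # outs) @ other @ rest)"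
    using ins pre by (subst wf_trace_inputs_append) auto
  moreover have "inputs_on c (proj c pre)" using ins by (force simp: inputs_on_def)
  moreover have "proj d tr = proj d ((proj c pre @ AOut c w # outs) @ other @ rest)" for d
    using or(3)[of d] proj_outputs_on[OF or(1), of d] proj_proj[of d c pre]
    by (simp add: tr(1) proj_other)
  moreover have "starts_input (proj c (other @ rest))"
    using or(4) by (simp add: proj_other)
  moreover have "mset tr = mset ((proj c pre @ AOut c w # outs) @ other @ rest)"
    using or(2) multiset_partition[of "mset pre" "action_on c"]
    by (simp add: tr(1) other_def flip: mset_filter)
  ultimately show ?thesis
    using that[of c "proj c pre" "AOut c w # outs" "other @ rest"] on by simp
qed

section \<open>Executions on families without silent actions\<close>

definition is_initial :: "('c \<Rightarrow> ('f, 'n, 'x, 'c) proc) \<Rightarrow> bool" where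
  "is_initial f \<longleftrightarrow> (\<forall>c. f c = Null \<or> (\<exists>d x P. f c = Inp d x P))"

lemma ext_simple_process_obtain_family:
  assumes "ext_simple_process Sig A" "initial A"
  obtains f \<Phi> where "A = (mset_of f, \<Phi>)" "family f" "is_initial f" "finite (dom \<Phi>)"
proof -
  obtain \<P> \<Phi> where A: "A = (\<P>, \<Phi>)" by (cases A)
  have "simple Sig \<P>" "finite (dom \<Phi>)" using assms(1) by (auto simp: ext_simple_process_def A)
  from simple_imp_family[OF this(1)] obtain f where
    f: "family f" "\<P> = mset_of f" "\<And>c. f c = Null \<or> f c \<in># \<P>" by blast
  have "is_initial f"
    unfolding is_initial_def using f(3) assms(2) by (fastforce simp: initial_def A)
  with that f A \<open>finite (dom \<Phi>)\<close> show ?thesis by blast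
qed

locale semantics =
  fixes Sig :: "('f \<times> nat) set"
    and E :: "(('f, 'n, 'x) msg \<times> ('f, 'n, 'x) msg) set"
begin

text \<open>Closed conditionals are independent of the frame, so they can be resolved eagerly; this makes
  the semantics free of silent actions and deterministic.\<close>

primrec resolve :: "('f, 'n, 'x, 'c) proc \<Rightarrow> ('f, 'n, 'x, 'c) proc" where
  "resolve Null = Null"
| "resolve (Cond u v P Q) = (if eq_mod Sig E u v then resolve P else resolve Q)"
| "resolve (Inp c x P) = Inp c x P"
| "resolve (Outp c u P) = Outp c u P"

lemma resolve_resolve [simp]: "resolve (resolve P) = resolve P"
  by (induction P) auto

lemma resolve_not_Cond: "resolve P \<noteq> Cond u v Q R"
  by (induction P) auto

lemma on_channel_resolve: "on_channel c P \<Longrightarrow> on_channel c (resolve P)"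
  by (induction P) auto

lemma num_actions_resolve_le: "num_actions (resolve P) \<le> num_actions P"
  by (induction P) auto

definition resolved :: "('c \<Rightarrow> ('f, 'n, 'x, 'c) proc) \<Rightarrow> bool" where
  "resolved f \<longleftrightarrow> (\<forall>c. resolve (f c) = f c)"

lemma resolved_cases:
  assumes "resolved f" "family f"
  obtains "f c = Null" | x P where "f c = Inp c x P" | u P where "f c = Outp c u P"
proof (cases "f c")
  case (Cond u v P Q)
  then show ?thesis using assms(1) resolve_not_Cond[of "f c"] by (metis resolved_def)
next
  case (Inp d x P)
  then have "d = c" using assms(2) unfolding family_def by (metis on_channel.simps(3))
  then show ?thesis using Inp that by blast
next
  case (Outp d u P)
  then have "d = c" using assms(2) unfolding family_def by (metis on_channel.simps(4))
  then show ?thesis using Outp that by blast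
qed (use that in blast)

lemma is_initial_resolved: "is_initial f \<Longrightarrow> resolved f"
  unfolding is_initial_def resolved_def by (metis resolve.simps(1,3))

text \<open>Each continuation is resolved at once, so a resolved family stays resolved and no rule
  for conditionals is required.\<close>

inductive exec :: "('c \<Rightarrow> ('f, 'n, 'x, 'c) proc) \<Rightarrow> ('f, 'n, 'x, 'w) frame \<Rightarrow>
    ('f, 'c, 'w) action list \<Rightarrow> ('c \<Rightarrow> ('f, 'n, 'x, 'c) proc) \<Rightarrow> ('f, 'n, 'x, 'w) frame \<Rightarrow> bool"
  where
  exec_Nil: "exec f \<Phi> [] f \<Phi>"
| exec_In: "f c = Inp c x P \<Longrightarrow> M \<in> terms Sig (dom \<Phi>) \<Longrightarrow>
    exec (f(c := resolve (proc_subst x (apply_frame \<Phi> M) P))) \<Phi> tr g \<Psi> \<Longrightarrow>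
    exec f \<Phi> (AIn c M # tr) g \<Psi>"
| exec_Out: "f c = Outp c u P \<Longrightarrow> w \<notin> dom \<Phi> \<Longrightarrow>
    exec (f(c := resolve P)) (\<Phi>(w \<mapsto> u)) tr g \<Psi> \<Longrightarrow> exec f \<Phi> (AOut c w # tr) g \<Psi>"

inductive_cases exec_NilE [elim!]: "exec f \<Phi> [] g \<Psi>"
inductive_cases exec_InE [elim!]: "exec f \<Phi> (AIn c M # tr) g \<Psi>"
inductive_cases exec_OutE [elim!]: "exec f \<Phi> (AOut c w # tr) g \<Psi>"
inductive_cases exec_TauE [elim!]: "exec f \<Phi> (Tau # tr) g \<Psi>"

lemma exec_single_In:
  "f c = Inp c x P \<Longrightarrow> M \<in> terms Sig (dom \<Phi>) \<Longrightarrow>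
    exec f \<Phi> [AIn c M] (f(c := resolve (proc_subst x (apply_frame \<Phi> M) P))) \<Phi>"
  by (rule exec_In[OF _ _ exec_Nil])

lemma exec_single_Out:
  "f c = Outp c u P \<Longrightarrow> w \<notin> dom \<Phi> \<Longrightarrow> exec f \<Phi> [AOut c w] (f(c := resolve P)) (\<Phi>(w \<mapsto> u))"
  by (rule exec_Out[OF _ _ exec_Nil])

text \<open>Each action names its channel and its recipe or handle, and the process at that channel
  leaves no choice.\<close>

lemma exec_deterministic: "exec f \<Phi> tr g \<Psi> \<Longrightarrow> exec f \<Phi> tr g' \<Psi>' \<Longrightarrow> g = g' \<and> \<Psi> = \<Psi>'"
proof (induction arbitrary: g' \<Psi>' rule: exec.induct)
  case (exec_In f c x P M \<Phi> tr g \<Psi>)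
  from exec_In.prems exec_In.hyps(1) show ?case
    by (elim exec_InE) (rule exec_In.IH, simp del: fun_upd_apply)
next
  case (exec_Out f c u P w \<Phi> tr g \<Psi>)
  from exec_Out.prems exec_Out.hyps(1) show ?case
    by (elim exec_OutE) (rule exec_Out.IH, simp del: fun_upd_apply)
qed auto

lemma exec_append:
  "exec f \<Phi> (tr @ tr') h \<Psi> \<longleftrightarrow> (\<exists>g \<Phi>'. exec f \<Phi> tr g \<Phi>' \<and> exec g \<Phi>' tr' h \<Psi>)"
proof
  show "exec f \<Phi> (tr @ tr') h \<Psi> \<Longrightarrow> \<exists>g \<Phi>'. exec f \<Phi> tr g \<Phi>' \<and> exec g \<Phi>' tr' h \<Psi>"
  proof (induction tr arbitrary: f \<Phi>)
    case Nil
    then show ?case using exec_Nil by fastforce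
  next
    case (Cons a tr)
    show ?case
    proof (cases a)
      case (AIn c M)
      with Cons show ?thesis by (simp del: fun_upd_apply) (metis exec_In exec_InE)
    next
      case (AOut c w)
      with Cons show ?thesis by (simp del: fun_upd_apply) (metis exec_Out exec_OutE)
    qed (use Cons in auto)
  qed
  have "exec f \<Phi> tr g \<Phi>' \<Longrightarrow> exec g \<Phi>' tr' h \<Psi> \<Longrightarrow> exec f \<Phi> (tr @ tr') h \<Psi>" for g \<Phi>'
    by (induction rule: exec.induct) (auto intro: exec.intros)
  then show "\<exists>g \<Phi>'. exec f \<Phi> tr g \<Phi>' \<and> exec g \<Phi>' tr' h \<Psi> \<Longrightarrow> exec f \<Phi> (tr @ tr') h \<Psi>"
    by blast
qed

lemma exec_family: "exec f \<Phi> tr g \<Psi> \<Longrightarrow> family f \<Longrightarrow> family g"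
proof (induction rule: exec.induct)
  case (exec_In f c x P M \<Phi> tr g \<Psi>)
  then have "on_channel c P" unfolding family_def by (metis on_channel.simps(3))
  with exec_In show ?case by (simp add: family_upd on_channel_proc_subst on_channel_resolve del: fun_upd_apply)
next
  case (exec_Out f c u P w \<Phi> tr g \<Psi>)
  then have "on_channel c P" unfolding family_def by (metis on_channel.simps(4))
  with exec_Out show ?case by (simp add: family_upd on_channel_resolve del: fun_upd_apply)
qed

lemma exec_resolved: "exec f \<Phi> tr g \<Psi> \<Longrightarrow> resolved f \<Longrightarrow> resolved g"
  by (induction rule: exec.induct) (auto simp: resolved_def)

lemma exec_dom_finite: "exec f \<Phi> tr g \<Psi> \<Longrightarrow> finite (dom \<Phi>) \<Longrightarrow> finite (dom \<Psi>)"
  by (induction rule: exec.induct) auto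

text \<open>The local semantics of one channel reads every message off the final frame of the whole
  execution; an execution then only depends on the projections of its trace to the channels.\<close>

fun local_step :: "('f, 'n, 'x, 'w) frame \<Rightarrow> ('f, 'c, 'w) action \<Rightarrow> ('f, 'n, 'x, 'c) proc \<Rightarrow>
    ('f, 'n, 'x, 'c) proc option" where
  "local_step \<Psi> (AIn c M) (Inp d x P) =
    (if c = d then Some (resolve (proc_subst x (apply_frame \<Psi> M) P)) else None)"
| "local_step \<Psi> (AOut c w) (Outp d u P) =
    (if c = d \<and> \<Psi> w = Some u then Some (resolve P) else None)"
| "local_step \<Psi> _ _ = None"

primrec local_run :: "('f, 'n, 'x, 'w) frame \<Rightarrow> ('f, 'c, 'w) action list \<Rightarrow>
    ('f, 'n, 'x, 'c) proc \<Rightarrow> ('f, 'n, 'x, 'c) proc option" where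
  "local_run \<Psi> [] P = Some P"
| "local_run \<Psi> (a # tr) P = Option.bind (local_step \<Psi> a P) (local_run \<Psi> tr)"

lemma local_step_InE:
  assumes "local_step \<Psi> (AIn c M) P = Some Q"
  obtains x P' where "P = Inp c x P'" "Q = resolve (proc_subst x (apply_frame \<Psi> M) P')"
  using assms by (cases P) (auto split: if_splits)

lemma local_step_OutE:
  assumes "local_step \<Psi> (AOut c w) P = Some Q"
  obtains u P' where "P = Outp c u P'" "\<Psi> w = Some u" "Q = resolve P'"
  using assms by (cases P) (auto split: if_splits)

lemma apply_frame_cong:
  "M \<in> terms Sig S \<Longrightarrow> (\<And>w. w \<in> S \<Longrightarrow> \<Phi> w = \<Psi> w) \<Longrightarrow> apply_frame \<Phi> M = apply_frame \<Psi> M"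
  by (induction rule: terms.induct) (auto simp: apply_frame_def)

lemma apply_frame_map_le:
  "M \<in> terms Sig (dom \<Phi>) \<Longrightarrow> \<Phi> \<subseteq>\<^sub>m \<Psi> \<Longrightarrow> apply_frame \<Psi> M = apply_frame \<Phi> M"
  by (rule apply_frame_cong[symmetric]) (auto simp: map_le_def)

text \<open>A recipe over the current handles has the same value in the final frame, which extends
  the current one. What remains global is \<open>wf_trace\<close> and the final domain; everything
  else is checked channel by channel, hence depends on projections only.\<close>

lemma exec_iff:
  "exec f \<Phi> tr g \<Psi> \<longleftrightarrow> wf_trace Sig (dom \<Phi>) tr \<and> \<Phi> \<subseteq>\<^sub>m \<Psi> \<and> dom \<Psi> = dom \<Phi> \<union> outputs tr \<and>
    (\<forall>c. local_run \<Psi> (proj c tr) (f c) = Some (g c))"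
proof (induction tr arbitrary: f \<Phi>)
  case Nil
  have "\<Phi> = \<Psi>" if "\<Phi> \<subseteq>\<^sub>m \<Psi>" "dom \<Psi> = dom \<Phi>"
    using that by (simp add: map_le_antisym map_le_def)
  then show ?case by (auto intro: exec_Nil)
next
  case (Cons a tr)
  show ?case
  proof (cases a)
    case Tau
    then show ?thesis by auto
  next
    case (AIn c M)
    show ?thesis
    proof
      assume "exec f \<Phi> (a # tr) g \<Psi>"
      then obtain x P where P: "f c = Inp c x P" "M \<in> terms Sig (dom \<Phi>)"
        and "exec (f(c := resolve (proc_subst x (apply_frame \<Phi> M) P))) \<Phi> tr g \<Psi>"
        unfolding AIn by blast
      note * = this(3)[unfolded Cons.IH]
      then have "apply_frame \<Psi> M = apply_frame \<Phi> M" using P(2) apply_frame_map_le by blast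
      with * P show "wf_trace Sig (dom \<Phi>) (a # tr) \<and> \<Phi> \<subseteq>\<^sub>m \<Psi> \<and>
          dom \<Psi> = dom \<Phi> \<union> outputs (a # tr) \<and>
          (\<forall>c. local_run \<Psi> (proj c (a # tr)) (f c) = Some (g c))"
        by (auto simp: AIn split: if_splits)
    next
      assume *: "wf_trace Sig (dom \<Phi>) (a # tr) \<and> \<Phi> \<subseteq>\<^sub>m \<Psi> \<and>
          dom \<Psi> = dom \<Phi> \<union> outputs (a # tr) \<and>
          (\<forall>c. local_run \<Psi> (proj c (a # tr)) (f c) = Some (g c))"
      then have "local_run \<Psi> (AIn c M # proj c tr) (f c) = Some (g c)"
        by (auto simp: AIn dest: spec[of _ c])
      then obtain x P where P: "f c = Inp c x P"
        and g: "local_run \<Psi> (proj c tr) (resolve (proc_subst x (apply_frame \<Psi> M) P)) = Some (g c)"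
        by (auto simp: bind_eq_Some_conv elim!: local_step_InE)
      have "M \<in> terms Sig (dom \<Phi>)" using * by (simp add: AIn)
      moreover from this have "apply_frame \<Psi> M = apply_frame \<Phi> M"
        using * apply_frame_map_le by blast
      moreover have "local_run \<Psi> (proj d tr) (f d) = Some (g d)" if "d \<noteq> c" for d
        using * that by (auto simp: AIn dest: spec[of _ d])
      ultimately show "exec f \<Phi> (a # tr) g \<Psi>"
        unfolding AIn using * P g by (intro exec_In) (auto simp: Cons.IH AIn)
    qed
  next
    case (AOut c w)
    show ?thesis
    proof
      assume "exec f \<Phi> (a # tr) g \<Psi>"
      then obtain u P where P: "f c = Outp c u P" "w \<notin> dom \<Phi>"
        and "exec (f(c := resolve P)) (\<Phi>(w \<mapsto> u)) tr g \<Psi>"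
        unfolding AOut by blast
      note * = this(3)[unfolded Cons.IH]
      then have le: "\<Phi>(w \<mapsto> u) \<subseteq>\<^sub>m \<Psi>" by blast
      then have w: "\<Psi> w = Some u" by (auto simp: map_le_def dest: bspec[of _ _ w])
      have "\<Phi> \<subseteq>\<^sub>m \<Phi>(w \<mapsto> u)" using P(2) by (auto simp: map_le_def)
      then have "\<Phi> \<subseteq>\<^sub>m \<Psi>" using le map_le_trans by blast
      moreover have "local_run \<Psi> (proj d (a # tr)) (f d) = Some (g d)" for d
      proof -
        have "local_run \<Psi> (proj d tr) ((f(c := resolve P)) d) = Some (g d)" using * by blast
        then show ?thesis using P(1) w by (auto simp: AOut split: if_splits)
      qed
      moreover have "wf_trace Sig (dom \<Phi>) (a # tr)" "dom \<Psi> = dom \<Phi> \<union> outputs (a # tr)"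
        using * P(2) by (simp_all add: AOut)
      ultimately show "wf_trace Sig (dom \<Phi>) (a # tr) \<and> \<Phi> \<subseteq>\<^sub>m \<Psi> \<and>
          dom \<Psi> = dom \<Phi> \<union> outputs (a # tr) \<and>
          (\<forall>c. local_run \<Psi> (proj c (a # tr)) (f c) = Some (g c))"
        by blast
    next
      assume *: "wf_trace Sig (dom \<Phi>) (a # tr) \<and> \<Phi> \<subseteq>\<^sub>m \<Psi> \<and>
          dom \<Psi> = dom \<Phi> \<union> outputs (a # tr) \<and>
          (\<forall>c. local_run \<Psi> (proj c (a # tr)) (f c) = Some (g c))"
      then have "local_run \<Psi> (AOut c w # proj c tr) (f c) = Some (g c)"
        by (auto simp: AOut dest: spec[of _ c])
      then obtain u P where P: "f c = Outp c u P" "\<Psi> w = Some u"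
        and g: "local_run \<Psi> (proj c tr) (resolve P) = Some (g c)"
        by (auto simp: bind_eq_Some_conv elim!: local_step_OutE)
      have "w \<notin> dom \<Phi>" using * by (simp add: AOut)
      \<comment> \<open>\<open>local_step\<close> has compared \<open>u\<close> with the entry of
        \<open>w\<close> in the final frame, so the extended frame still lies below it.\<close>
      moreover have "\<Phi>(w \<mapsto> u) \<subseteq>\<^sub>m \<Psi>" using * P(2) by (auto simp: map_le_def)
      moreover have "local_run \<Psi> (proj d tr) (f d) = Some (g d)" if "d \<noteq> c" for d
        using * that by (auto simp: AOut dest: spec[of _ d])
      ultimately have "exec (f(c := resolve P)) (\<Phi>(w \<mapsto> u)) tr g \<Psi>"
        unfolding Cons.IH using * g by (auto simp: AOut simp del: fun_upd_apply)
          (simp split: if_splits)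
      with P(1) \<open>w \<notin> dom \<Phi>\<close> show "exec f \<Phi> (a # tr) g \<Psi>"
        unfolding AOut by (rule exec_Out)
    qed
  qed
qed

lemma exec_reorder:
  assumes "exec f \<Phi> tr g \<Psi>" "wf_trace Sig (dom \<Phi>) tr'"
    and "\<And>d. proj d tr = proj d tr'" "set tr = set tr'"
  shows "exec f \<Phi> tr' g \<Psi>"
  using assms by (simp add: exec_iff outputs_def)

lemma exec_other_channel: "exec f \<Phi> tr g \<Psi> \<Longrightarrow> proj c tr = [] \<Longrightarrow> g c = f c"
  by (auto simp: exec_iff dest: spec[of _ c])

text \<open>Recipes over the smaller domain have the same values in the larger frames. This allows
  an execution to be prolonged, matched and cut back.\<close>

lemma static_equiv_map_le:
  assumes "static_equiv Sig E \<Phi> \<Psi>" "\<Phi>' \<subseteq>\<^sub>m \<Phi>" "\<Psi>' \<subseteq>\<^sub>m \<Psi>" "dom \<Phi>' = dom \<Psi>'"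
  shows "static_equiv Sig E \<Phi>' \<Psi>'"
  using assms apply_frame_map_le[OF _ assms(2)] apply_frame_map_le[OF _ assms(3)]
    map_le_implies_dom_le[OF assms(2)]
  unfolding static_equiv_def by (metis terms_mono)

section \<open>Concrete executions\<close>

lemma step_from_mset_of:
  assumes "family f" "step Sig E (mset_of f, \<Phi>) a B"
  obtains c P' \<Phi>' where "basic_step Sig E (f c, \<Phi>) a (P', \<Phi>')" "B = (mset_of (f(c := P')), \<Phi>')"
  using assms(2)
proof cases
  case (1 P P' \<Phi>' \<P>)
  then obtain c where "f c = P" "\<P> = mset_of (f(c := Null))"
    using mset_of_add_msetE[OF assms(1), of P \<P>] by blast
  then show ?thesis using that 1 add_proc_mset_of[OF assms(1)] by auto
qed

lemma step_mset_ofI: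
  assumes "family f" "basic_step Sig E (f c, \<Phi>) a (P', \<Phi>')"
  shows "step Sig E (mset_of f, \<Phi>) a (mset_of (f(c := P')), \<Phi>')"
proof -
  have "f c \<noteq> Null" using assms(2) by (auto elim: basic_step.cases)
  then show ?thesis
    using step.intros[OF assms(2), of "mset_of (f(c := Null))"]
      mset_of_remove[OF assms(1)] add_proc_mset_of[OF assms(1)] by simp
qed

lemma on_channel_basic_step:
  "basic_step Sig E (P, \<Phi>) a (P', \<Phi>') \<Longrightarrow> on_channel c P \<Longrightarrow> on_channel c P'"
  by (erule basic_step.cases) (auto intro: on_channel_proc_subst)

lemma resolve_upd: "resolve \<circ> f(c := P) = (resolve \<circ> f)(c := resolve P)"
  by auto

text \<open>A silent step replaces a conditional by the branch that \<open>resolve\<close> selects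
  as well, so \<open>resolve \<circ> f\<close> does not notice it.\<close>

lemma steps_imp_exec:
  assumes "steps Sig E (mset_of f, \<Phi>) as (\<P>, \<Psi>)" "family f"
  shows "\<exists>g. exec (resolve \<circ> f) \<Phi> (filter (\<lambda>a. a \<noteq> Tau) as) g \<Psi>"
  using assms
proof (induction as arbitrary: f \<Phi>)
  case Nil
  then show ?case by (auto elim!: steps.cases intro: exec_Nil)
next
  case (Cons a as)
  from Cons.prems(1) obtain B where "step Sig E (mset_of f, \<Phi>) a B" "steps Sig E B as (\<P>, \<Psi>)"
    by (auto elim: steps.cases)
  then obtain c P' \<Phi>' where b: "basic_step Sig E (f c, \<Phi>) a (P', \<Phi>')"
    and s: "steps Sig E (mset_of (f(c := P')), \<Phi>') as (\<P>, \<Psi>)"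
    using step_from_mset_of[OF Cons.prems(2)] by metis
  have oc: "on_channel c (f c)" using Cons.prems(2) by (simp add: family_def)
  then have "family (f(c := P'))"
    by (rule family_upd[OF Cons.prems(2) on_channel_basic_step[OF b]])
  then obtain g where
    g: "exec ((resolve \<circ> f)(c := resolve P')) \<Phi>' (filter (\<lambda>a. a \<noteq> Tau) as) g \<Psi>"
    using Cons.IH[OF s] unfolding resolve_upd by blast
  have tau: "exec (resolve \<circ> f) \<Phi>' (filter (\<lambda>a. a \<noteq> Tau) as) g \<Psi>"
    if "resolve P' = resolve (f c)"
    using g that by (simp add: fun_upd_idem)
  from b show ?case
  proof cases
    case (step_then u v Q)
    then have "resolve P' = resolve (f c)" by simp
    from tau[OF this] step_then(2,3) show ?thesis by (intro exI[of _ g]) (simp add: o_def)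
  next
    case (step_else u v P)
    then have "resolve P' = resolve (f c)" by simp
    from tau[OF this] step_else(2,3) show ?thesis by (intro exI[of _ g]) (simp add: o_def)
  next
    case (step_in M d x P)
    moreover from this have "d = c" using oc by simp
    ultimately have "exec (resolve \<circ> f) \<Phi> (a # filter (\<lambda>a. a \<noteq> Tau) as) g \<Psi>"
      using g exec_In[of "resolve \<circ> f" c x P M \<Phi>] by simp
    with step_in(2) show ?thesis by (intro exI[of _ g]) (simp add: o_def)
  next
    case (step_out w d u)
    moreover from this have "d = c" using oc by simp
    ultimately have "exec (resolve \<circ> f) \<Phi> (a # filter (\<lambda>a. a \<noteq> Tau) as) g \<Psi>"
      using g exec_Out[of "resolve \<circ> f" c u P' w \<Phi>] by simp
    with step_out(2) show ?thesis by (intro exI[of _ g]) (simp add: o_def)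
  qed
qed

lemma weak_steps_Nil: "weak_steps Sig E A [] A"
  unfolding weak_steps_def by (auto intro: exI[of _ "[]"] steps_Nil)

lemma weak_steps_Cons:
  "step Sig E A a B \<Longrightarrow> weak_steps Sig E B tr C \<Longrightarrow>
    weak_steps Sig E A (if a = Tau then tr else a # tr) C"
  unfolding weak_steps_def by (auto intro: steps_Cons exI[of _ "a # as" for as])

text \<open>The induction follows the conditionals pending at \<open>c\<close>, one erased silent
  step for each.\<close>

lemma weak_steps_resolve:
  "family f \<Longrightarrow> weak_steps Sig E (mset_of (f(c := resolve (f c))), \<Phi>) tr C \<Longrightarrow>
    weak_steps Sig E (mset_of f, \<Phi>) tr C"
proof (induction "f c" arbitrary: f)
  case (Cond u v P Q)
  have eq: "f c = Cond u v P Q" using Cond by simp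
  then have "on_channel c (Cond u v P Q)" using Cond.prems(1) by (metis family_def)
  then have fam: "family (f(c := P))" "family (f(c := Q))"
    using Cond.prems(1) by (auto intro: family_upd)
  show ?case
  proof (cases "eq_mod Sig E u v")
    case True
    then have "step Sig E (mset_of f, \<Phi>) Tau (mset_of (f(c := P)), \<Phi>)"
      using eq by (intro step_mset_ofI[OF Cond.prems(1)]) (simp add: step_then)
    moreover have "weak_steps Sig E (mset_of (f(c := P)), \<Phi>) tr C"
      by (rule Cond.hyps(1)) (use Cond.prems(2) True fam in \<open>simp_all add: eq\<close>)
    ultimately show ?thesis using weak_steps_Cons by fastforce
  next
    case False
    then have "step Sig E (mset_of f, \<Phi>) Tau (mset_of (f(c := Q)), \<Phi>)"
      using eq by (intro step_mset_ofI[OF Cond.prems(1)]) (simp add: step_else)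
    moreover have "weak_steps Sig E (mset_of (f(c := Q)), \<Phi>) tr C"
      by (rule Cond.hyps(2)) (use Cond.prems(2) False fam in \<open>simp_all add: eq\<close>)
    ultimately show ?thesis using weak_steps_Cons by fastforce
  qed
next
  case Null
  then have "f(c := resolve (f c)) = f" by (metis fun_upd_triv resolve.simps(1))
  with Null.prems(2) show ?case by simp
next
  case (Inp d x P)
  then have "f(c := resolve (f c)) = f" by (metis fun_upd_triv resolve.simps(3))
  with Inp.prems(2) show ?case by simp
next
  case (Outp d u P)
  then have "f(c := resolve (f c)) = f" by (metis fun_upd_triv resolve.simps(4))
  with Outp.prems(2) show ?case by simp
qed

text \<open>Conditionals are executed lazily, just before the next action on their channel. Those
  pending at the end remain, hence the unspecified final multiset; the equivalences compare frames
  only.\<close>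

lemma exec_imp_weak_steps:
  assumes "exec (resolve \<circ> f) \<Phi> tr g \<Psi>" "family f"
  shows "\<exists>\<P>. weak_steps Sig E (mset_of f, \<Phi>) tr (\<P>, \<Psi>)"
  using assms
proof (induction tr arbitrary: f \<Phi>)
  case Nil
  then show ?case by (auto intro: weak_steps_Nil)
next
  case (Cons a tr)
  have fam: "family (f(c := resolve (f c)))" for c
    using Cons.prems(2) by (intro family_upd on_channel_resolve family_on_channel)
  show ?case
  proof (cases a)
    case Tau
    with Cons.prems show ?thesis by auto
  next
    case (AIn c M)
    obtain x P where "(resolve \<circ> f) c = Inp c x P" "M \<in> terms Sig (dom \<Phi>)"
      and "exec ((resolve \<circ> f)(c := resolve (proc_subst x (apply_frame \<Phi> M) P))) \<Phi> tr g \<Psi>"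
      using Cons.prems(1) unfolding AIn by (rule exec_InE)
    then have P: "resolve (f c) = Inp c x P" "M \<in> terms Sig (dom \<Phi>)"
      and ex: "exec (resolve \<circ> f(c := proc_subst x (apply_frame \<Phi> M) P)) \<Phi> tr g \<Psi>"
      unfolding resolve_upd by simp_all
    let ?f = "f(c := Inp c x P)"
    have "step Sig E (mset_of ?f, \<Phi>) a (mset_of (?f(c := proc_subst x (apply_frame \<Phi> M) P)), \<Phi>)"
      using fam[of c] P by (intro step_mset_ofI) (auto simp: AIn intro: step_in)
    moreover have "on_channel c P" using family_on_channel[OF fam[of c], of c] P by simp
    then have "family (f(c := proc_subst x (apply_frame \<Phi> M) P))"
      using Cons.prems(2) by (intro family_upd on_channel_proc_subst)
    ultimately obtain \<P> where "weak_steps Sig E (mset_of ?f, \<Phi>) (a # tr) (\<P>, \<Psi>)"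
      using Cons.IH[OF ex] weak_steps_Cons AIn by fastforce
    then show ?thesis using weak_steps_resolve[OF Cons.prems(2), of c \<Phi> "a # tr" "(\<P>, \<Psi>)"] P(1) by auto
  next
    case (AOut c w)
    obtain u P where "(resolve \<circ> f) c = Outp c u P" "w \<notin> dom \<Phi>"
      and "exec ((resolve \<circ> f)(c := resolve P)) (\<Phi>(w \<mapsto> u)) tr g \<Psi>"
      using Cons.prems(1) unfolding AOut by (rule exec_OutE)
    then have P: "resolve (f c) = Outp c u P" "w \<notin> dom \<Phi>"
      and ex: "exec (resolve \<circ> f(c := P)) (\<Phi>(w \<mapsto> u)) tr g \<Psi>"
      unfolding resolve_upd by simp_all
    let ?f = "f(c := Outp c u P)"
    have "step Sig E (mset_of ?f, \<Phi>) a (mset_of (?f(c := P)), \<Phi>(w \<mapsto> u))"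
      using fam[of c] P by (intro step_mset_ofI) (auto simp: AOut intro: step_out)
    moreover have "on_channel c P" using family_on_channel[OF fam[of c], of c] P by simp
    then have "family (f(c := P))" using Cons.prems(2) by (intro family_upd)
    ultimately obtain \<P> where "weak_steps Sig E (mset_of ?f, \<Phi>) (a # tr) (\<P>, \<Psi>)"
      using Cons.IH[OF ex] weak_steps_Cons AOut by fastforce
    then show ?thesis using weak_steps_resolve[OF Cons.prems(2), of c \<Phi> "a # tr" "(\<P>, \<Psi>)"] P(1) by auto
  qed
qed

lemma weak_steps_iff_exec:
  assumes "family f" "resolved f"
  shows "(\<exists>\<P>. weak_steps Sig E (mset_of f, \<Phi>) tr (\<P>, \<Psi>)) \<longleftrightarrow> (\<exists>g. exec f \<Phi> tr g \<Psi>)"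
proof -
  have eq: "resolve \<circ> f = f" using assms(2) by (auto simp: resolved_def)
  show ?thesis
  proof
    assume "\<exists>\<P>. weak_steps Sig E (mset_of f, \<Phi>) tr (\<P>, \<Psi>)"
    then obtain \<P> as where "steps Sig E (mset_of f, \<Phi>) as (\<P>, \<Psi>)" "filter (\<lambda>a. a \<noteq> Tau) as = tr"
      unfolding weak_steps_def by blast
    with steps_imp_exec[OF this(1) assms(1)] show "\<exists>g. exec f \<Phi> tr g \<Psi>" by (simp add: eq)
  next
    assume "\<exists>g. exec f \<Phi> tr g \<Psi>"
    then show "\<exists>\<P>. weak_steps Sig E (mset_of f, \<Phi>) tr (\<P>, \<Psi>)"
      using exec_imp_weak_steps[OF _ assms(1), unfolded eq] by blast
  qed
qed

section \<open>Compressed executions\<close>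

text \<open>In the target, \<open>None\<close> stands for the empty process reached after an improper block.\<close>

inductive block_exec :: "('c \<Rightarrow> ('f, 'n, 'x, 'c) proc) \<Rightarrow> ('f, 'n, 'x, 'w) frame \<Rightarrow>
    ('f, 'c, 'w) action list \<Rightarrow> ('c \<Rightarrow> ('f, 'n, 'x, 'c) proc) option \<Rightarrow>
    ('f, 'n, 'x, 'w) frame \<Rightarrow> bool"
  where
  block_Nil: "block_exec f \<Phi> [] (Some f) \<Phi>"
| block_proper: "inputs_on c ins \<Longrightarrow> outputs_on c outs \<Longrightarrow> ins \<noteq> [] \<Longrightarrow> outs \<noteq> [] \<Longrightarrow>
    exec f \<Phi> (ins @ outs) g \<Phi>' \<Longrightarrow> is_initial g \<Longrightarrow> block_exec g \<Phi>' tr r \<Psi> \<Longrightarrow>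
    block_exec f \<Phi> ((ins @ outs) @ tr) r \<Psi>"
| block_improper: "inputs_on c ins \<Longrightarrow> ins \<noteq> [] \<Longrightarrow> exec f \<Phi> ins g \<Psi> \<Longrightarrow> g c = Null \<Longrightarrow>
    block_exec f \<Phi> ins None \<Psi>"

lemma block_exec_imp_exec: "block_exec f \<Phi> tr r \<Psi> \<Longrightarrow> \<exists>g. exec f \<Phi> tr g \<Psi>"
proof (induction rule: block_exec.induct)
  case (block_proper c ins outs f \<Phi> g \<Phi>' tr r \<Psi>)
  then show ?case unfolding exec_append[of f \<Phi> "ins @ outs" tr] by blast
qed (auto intro: exec_Nil)

lemma block_exec_append:
  "block_exec f \<Phi> tr (Some g) \<Phi>' \<Longrightarrow> block_exec g \<Phi>' tr' r \<Psi> \<Longrightarrow> block_exec f \<Phi> (tr @ tr') r \<Psi>"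
proof (induction f \<Phi> tr "Some g" \<Phi>' rule: block_exec.induct)
  case (block_proper c ins outs f \<Phi> g' \<Phi>' tr \<Psi>')
  then show ?case
    using block_exec.block_proper[of c ins outs f \<Phi> g' \<Phi>' "tr @ tr'" r \<Psi>] by simp
qed auto

lemma block_exec_starts_input: "block_exec f \<Phi> tr r \<Psi> \<Longrightarrow> starts_input tr"
proof (induction rule: block_exec.induct)
  case (block_proper c ins outs f \<Phi> g \<Phi>' tr r \<Psi>)
  then show ?case by (cases ins) (auto simp: starts_input_def)
next
  case (block_improper c ins f \<Phi> g \<Psi>)
  then show ?case by (cases ins) (auto simp: starts_input_def)
qed (simp add: starts_input_def)

text \<open>Inverts a run along a given block. The output excludes the improper rule, and
  \<open>starts_input tr\<close> prevents the run from counting outputs of \<open>tr\<close> as part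
  of the block.\<close>

lemma block_exec_properD:
  assumes "block_exec f \<Phi> ((ins @ outs) @ tr) r \<Psi>"
    and "inputs_on c ins" "outputs_on c outs" "outs \<noteq> []" "starts_input tr"
  obtains g \<Phi>' where "exec f \<Phi> (ins @ outs) g \<Phi>'" "is_initial g" "block_exec g \<Phi>' tr r \<Psi>"
  using assms(1)
proof cases
  case (block_proper c' ins' outs' g \<Phi>' tr')
  then have "ins = ins' \<and> outs = outs' \<and> tr = tr'"
    using block_append_unique[OF assms(2-5), of c' ins' outs' tr'] block_exec_starts_input
    by (simp add: block_exec_starts_input)
  then show ?thesis using block_proper that by blast
next
  case (block_improper c' g)
  then show ?thesis using assms(3,4) by (cases outs) (auto simp: inputs_on_def)
qed (use assms(4) in simp)

text \<open>The labels of focused derivations from mode \<open>l\<close>; \<open>proper\<close>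
  tells which axiom ends the derivation. The proper end lies in mode \<open>OStar\<close>, which the
  input modes reach only by an output; the improper end lies in mode \<open>IStar\<close>, to which
  no output leads.\<close>

definition block_shape :: "mode \<Rightarrow> 'c \<Rightarrow> bool \<Rightarrow> ('f, 'c, 'w) action list \<Rightarrow> bool" where
  "block_shape l c proper tr \<longleftrightarrow> (\<exists>ins outs. tr = ins @ outs \<and> inputs_on c ins \<and> outputs_on c outs \<and>
    (l = IPlus \<longrightarrow> ins \<noteq> []) \<and> (l = OStar \<longrightarrow> ins = []) \<and>
    (if proper then l = OStar \<or> outs \<noteq> [] else outs = [] \<and> l \<noteq> OStar))"

lemma block_shape_In:
  "block_shape IStar c p tr \<Longrightarrow> l \<in> {IStar, IPlus} \<Longrightarrow> block_shape l c p (AIn c M # tr)"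
  unfolding block_shape_def
  by (elim exE, rename_tac ins outs, rule_tac x = "AIn c M # ins" in exI) auto

lemma block_shape_Out:
  "block_shape OStar c p tr \<Longrightarrow> l \<in> {IStar, OStar} \<Longrightarrow> block_shape l c p (AOut c w # tr)"
  unfolding block_shape_def
  by (intro exI[of _ "[]"] exI[of _ "AOut c w # tr"]) (auto split: if_splits)

text \<open>Assuming \<open>f c = resolve P\<close> rather than \<open>f c = P\<close> lets a silent
  step be absorbed without changing \<open>f\<close>.\<close>

lemma focused_imp_exec:
  assumes "focused Sig E l (P, \<Phi>) tr (R, \<Psi>)" "f c = resolve P" "on_channel c P"
  shows "\<exists>Q. exec f \<Phi> tr (f(c := Q)) \<Psi> \<and> block_shape l c (R \<noteq> None) tr \<and> on_channel c Q \<and>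
    (case R of None \<Rightarrow> Q = Null | Some Q' \<Rightarrow> Q = Q' \<and> (Q = Null \<or> (\<exists>d x P'. Q = Inp d x P')))"
  using assms
proof (induction l "(P, \<Phi>)" tr "(R, \<Psi>)" arbitrary: f P \<Phi> rule: focused.induct)
  case (foc_in d M K' tr l)
  from foc_in.hyps(1) obtain x P' where P': "P = Inp d x P'" "M \<in> terms Sig (dom \<Phi>)"
    "K' = (proc_subst x (apply_frame \<Phi> M) P', \<Phi>)" by cases auto
  then have d: "d = c" "on_channel c (proc_subst x (apply_frame \<Phi> M) P')"
    using foc_in.prems by (auto intro: on_channel_proc_subst)
  let ?f = "f(c := resolve (proc_subst x (apply_frame \<Phi> M) P'))"
  from foc_in.hyps(3)[OF P'(3), of ?f] d obtain Q where
    "exec ?f \<Phi> tr (f(c := Q)) \<Psi>" "block_shape IStar c (R \<noteq> None) tr" "on_channel c Q"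
    "case R of None \<Rightarrow> Q = Null | Some Q' \<Rightarrow> Q = Q' \<and> (Q = Null \<or> (\<exists>d x P'. Q = Inp d x P'))"
    by auto
  with exec_In[of f c x P' M \<Phi>] show ?case
    using foc_in.prems foc_in.hyps(4) P' d by (auto intro!: exI[of _ Q] block_shape_In)
next
  case (foc_out d w K' tr l)
  from foc_out.hyps(1) obtain u P' where P': "P = Outp d u P'" "w \<notin> dom \<Phi>" "K' = (P', \<Phi>(w \<mapsto> u))"
    by cases auto
  then have d: "d = c" "on_channel c P'" using foc_out.prems by auto
  let ?f = "f(c := resolve P')"
  from foc_out.hyps(3)[OF P'(3), of ?f] d obtain Q where
    "exec ?f (\<Phi>(w \<mapsto> u)) tr (f(c := Q)) \<Psi>" "block_shape OStar c (R \<noteq> None) tr" "on_channel c Q"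
    "case R of None \<Rightarrow> Q = Null | Some Q' \<Rightarrow> Q = Q' \<and> (Q = Null \<or> (\<exists>d x P'. Q = Inp d x P'))"
    by auto
  with exec_Out[of f c u P' w \<Phi>] show ?case
    using foc_out.prems foc_out.hyps(4) P' d by (auto intro!: exI[of _ Q] block_shape_Out)
next
  case (foc_tau K' l tr)
  from foc_tau.hyps(1) obtain P' where P': "K' = (P', \<Phi>)" "resolve P' = resolve P" "on_channel c P'"
    using foc_tau.prems(2) by cases auto
  then show ?case using foc_tau.hyps(3)[OF P'(1)] foc_tau.prems by simp
next
  case foc_proper
  then show ?case
    by (intro exI[of _ "f c"]) (auto simp: block_shape_def fun_upd_idem intro: exec_Nil)
next
  case foc_improper
  then show ?case
    by (intro exI[of _ Null]) (auto simp: block_shape_def fun_upd_idem intro: exec_Nil)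
qed

lemma compressed_imp_block_exec:
  assumes "compressed Sig E A tr B" "A = (mset_of f, \<Phi>)" "family f" "is_initial f"
  shows "\<exists>r. block_exec f \<Phi> tr r (snd B) \<and>
    (case r of None \<Rightarrow> fst B = {#} | Some g \<Rightarrow> fst B = mset_of g \<and> family g \<and> is_initial g)"
  using assms
proof (induction arbitrary: f \<Phi> rule: compressed.induct)
  case (comp_refl A)
  then show ?case by (auto intro!: exI[of _ "Some f"] block_Nil)
next
  case (comp_trans A tr B tr' C)
  then obtain r where r: "block_exec f \<Phi> tr r (snd B)"
    "case r of None \<Rightarrow> fst B = {#} | Some g \<Rightarrow> fst B = mset_of g \<and> family g \<and> is_initial g"
    by blast
  show ?case
  proof (cases r)
    case None
    let ?n = "\<lambda>_. Null :: ('f, 'n, 'x, 'a) proc"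
    have "B = (mset_of ?n, snd B)" using r(2) None by (simp add: prod_eq_iff)
    moreover have "family ?n" "is_initial ?n" by (auto simp: family_def is_initial_def)
    ultimately obtain r' where r': "block_exec ?n (snd B) tr' r' (snd C)"
      "case r' of None \<Rightarrow> fst C = {#} | Some g \<Rightarrow> fst C = mset_of g \<and> family g \<and> is_initial g"
      using comp_trans.IH(2) by blast
    \<comment> \<open>After an improper block no process is left, so the second trace has to be
      empty.\<close>
    have "tr' = []" if "exec ?n (snd B) tr' g (snd C)" for g
      using that by (cases rule: exec.cases) auto
    then have "tr' = []" using block_exec_imp_exec[OF r'(1)] by blast
    with r'(1) have "r' = Some ?n \<and> snd C = snd B" by (cases rule: block_exec.cases) auto
    with r' r None \<open>tr' = []\<close> show ?thesis by (auto intro!: exI[of _ None])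
  next
    case (Some g)
    then have "B = (mset_of g, snd B)" "family g" "is_initial g"
      using r(2) by (simp_all add: prod_eq_iff)
    from comp_trans.IH(2)[OF this] show ?thesis
      using block_exec_append[OF r(1)[unfolded Some]] by blast
  qed
next
  case (comp_proper Q \<Phi>0 tr Q' \<Phi>' \<P>)
  then have eq: "mset_of f = add_mset Q \<P>" "\<Phi>0 = \<Phi>" by simp_all
  then obtain c where c: "f c = Q" "\<P> = mset_of (f(c := Null))"
    using mset_of_add_msetE[OF comp_proper.prems(2) eq(1)] by blast
  have "f c = resolve Q" "on_channel c Q"
    using is_initial_resolved[OF comp_proper.prems(3)] comp_proper.prems(2) c
    by (auto simp: resolved_def family_def)
  from focused_imp_exec[OF comp_proper.hyps, of f c, OF this] c eq(2) obtain ins outs where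
    b: "exec f \<Phi> (ins @ outs) (f(c := Q')) \<Phi>'" "on_channel c Q'"
      "Q' = Null \<or> (\<exists>d x P'. Q' = Inp d x P')"
      "tr = ins @ outs" "inputs_on c ins" "outputs_on c outs" "ins \<noteq> []" "outs \<noteq> []"
    by (auto simp: block_shape_def)
  have g: "is_initial (f(c := Q'))" "family (f(c := Q'))"
    using comp_proper.prems b by (auto simp: is_initial_def intro: family_upd)
  have "block_exec f \<Phi> ((ins @ outs) @ []) (Some (f(c := Q'))) \<Phi>'"
    by (rule block_proper[OF b(5-8,1) g(1) block_Nil])
  with b(4) g show ?case
    by (auto simp: c(2) add_proc_mset_of[OF comp_proper.prems(2)] intro!: exI[of _ "Some (f(c := Q'))"])
next
  case (comp_improper Q \<Phi>0 tr \<Phi>' \<P>)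
  then have eq: "mset_of f = add_mset Q \<P>" "\<Phi>0 = \<Phi>" by simp_all
  then obtain c where c: "f c = Q" "\<P> = mset_of (f(c := Null))"
    using mset_of_add_msetE[OF comp_improper.prems(2) eq(1)] by blast
  have "f c = resolve Q" "on_channel c Q"
    using is_initial_resolved[OF comp_improper.prems(3)] comp_improper.prems(2) c
    by (auto simp: resolved_def family_def)
  from focused_imp_exec[OF comp_improper.hyps, of f c, OF this] c eq(2) have
    "exec f \<Phi> tr (f(c := Null)) \<Phi>'" "inputs_on c tr" "tr \<noteq> []"
    by (auto simp: block_shape_def)
  from block_improper[OF this(2,3,1)] show ?case by (auto intro!: exI[of _ None])
qed

section \<open>From executions of blocks back to focused derivations\<close>

lemma focused_resolve:
  "focused Sig E l (resolve P, \<Phi>) tr R \<Longrightarrow> focused Sig E l (P, \<Phi>) tr R"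
proof (induction P)
  case (Cond u v P Q)
  then show ?case
    by (cases "eq_mod Sig E u v")
      (auto intro: foc_tau[OF step_then] foc_tau[OF step_else])
qed auto

text \<open>The empty trace has to be excluded: a proper end is available in mode
  \<open>OStar\<close> only, and the first output is what leads there from
  \<open>IStar\<close>.\<close>

lemma focused_IStar_if_OStar:
  "focused Sig E OStar K tr R \<Longrightarrow> tr \<noteq> [] \<Longrightarrow> focused Sig E IStar K tr R"
proof (induction OStar K tr R rule: focused.induct)
  case (foc_out K c w K' tr K'')
  then show ?case by (intro focused.foc_out) simp_all
next
  case (foc_tau K K' tr K'')
  then show ?case by (metis focused.foc_tau)
qed simp_all

lemma focused_IPlus_if_IStar:
  "focused Sig E IStar K (AIn c M # tr) R \<Longrightarrow> focused Sig E IPlus K (AIn c M # tr) R"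
proof (induction IStar K "AIn c M # tr" R rule: focused.induct)
  case (foc_in K K' K'')
  then show ?case by (intro focused.foc_in) simp_all
next
  case (foc_tau K K' K'')
  then show ?case by (metis focused.foc_tau)
qed

lemma exec_outputs_imp_focused:
  assumes "exec f \<Phi> outs g \<Psi>" "outputs_on c outs" "f c = resolve P"
    and "g c = Null \<or> (\<exists>d x P'. g c = Inp d x P')"
  shows "focused Sig E OStar (P, \<Phi>) outs (Some (g c), \<Psi>)"
  using assms
proof (induction outs arbitrary: f P \<Phi>)
  case Nil
  then have "g = f" "\<Psi> = \<Phi>" "g c = resolve P" by auto
  with Nil.prems(4) show ?case by - (rule focused_resolve, simp add: foc_proper)
next
  case (Cons a outs)
  then obtain w where a: "a = AOut c w" by auto
  with Cons.prems obtain u P' where P': "f c = Outp c u P'" "w \<notin> dom \<Phi>"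
    "exec (f(c := resolve P')) (\<Phi>(w \<mapsto> u)) outs g \<Psi>" by blast
  have "focused Sig E OStar (P', \<Phi>(w \<mapsto> u)) outs (Some (g c), \<Psi>)"
    using Cons.prems by (intro Cons.IH[OF P'(3)]) auto
  from foc_out[OF step_out[OF P'(2)] this, of OStar c] show ?case
    using P'(1) Cons.prems(3) by - (rule focused_resolve, simp add: a)
qed

text \<open>The last assumption supplies the derivation behind the inputs: outputs with a proper
  end, or the empty trace with an improper end. Both kinds of block thus share this
  induction.\<close>

lemma exec_inputs_imp_focused:
  assumes "exec f \<Phi> (ins @ outs) g \<Psi>" "inputs_on c ins" "f c = resolve P"
    and "\<And>f \<Phi> P. exec f \<Phi> outs g \<Psi> \<Longrightarrow> f c = resolve P \<Longrightarrow> focused Sig E IStar (P, \<Phi>) outs R"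
  shows "focused Sig E IStar (P, \<Phi>) (ins @ outs) R"
  using assms
proof (induction ins arbitrary: f P \<Phi>)
  case (Cons a ins)
  then obtain M where a: "a = AIn c M" by auto
  with Cons.prems obtain x P' where P': "f c = Inp c x P'" "M \<in> terms Sig (dom \<Phi>)"
    "exec (f(c := resolve (proc_subst x (apply_frame \<Phi> M) P'))) \<Phi> (ins @ outs) g \<Psi>"
    by (metis exec_InE append_Cons)
  have "focused Sig E IStar (proc_subst x (apply_frame \<Phi> M) P', \<Phi>) (ins @ outs) R"
    using Cons.prems by (intro Cons.IH[OF P'(3)]) auto
  from foc_in[OF step_in[OF P'(2)] this, of IStar c] show ?case
    using P'(1) Cons.prems(3) by - (rule focused_resolve, simp add: a)
qed auto

lemma block_exec_imp_compressed:
  assumes "block_exec f \<Phi> tr r \<Psi>" "family f" "is_initial f"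
  shows "\<exists>\<P>. compressed Sig E (mset_of f, \<Phi>) tr (\<P>, \<Psi>)"
  using assms
proof (induction rule: block_exec.induct)
  case (block_Nil f \<Phi>)
  then show ?case using comp_refl by blast
next
  case (block_proper c ins outs f \<Phi> g \<Phi>' tr r \<Psi>)
  obtain M ins' where ins: "ins = AIn c M # ins'" "inputs_on c ins'"
    using block_proper.hyps(1,3) by (cases ins) auto
  have res: "f c = resolve (f c)"
    using is_initial_resolved[OF block_proper.prems(2)] by (simp add: resolved_def)
  have "g c = Null \<or> (\<exists>d x P'. g c = Inp d x P')"
    using block_proper.hyps(6) by (simp add: is_initial_def)
  then have "focused Sig E IStar (P, \<Phi>) outs (Some (g c), \<Phi>')"
    if "exec f \<Phi> outs g \<Phi>'" "f c = resolve P" for f \<Phi> P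
    using focused_IStar_if_OStar[OF exec_outputs_imp_focused[OF that(1) block_proper.hyps(2) that(2)]]
      block_proper.hyps(4) by blast
  from exec_inputs_imp_focused[OF block_proper.hyps(5,1) res this]
  have "focused Sig E IStar (f c, \<Phi>) (ins @ outs) (Some (g c), \<Phi>')" .
  then have "focused Sig E IPlus (f c, \<Phi>) (ins @ outs) (Some (g c), \<Phi>')"
    using focused_IPlus_if_IStar by (simp add: ins)
  from comp_proper[OF this, of "mset_of (f(c := Null))"]
  have "compressed Sig E (mset_of f, \<Phi>) (ins @ outs) (mset_of (f(c := g c)), \<Phi>')"
    using block_proper.hyps(5) block_proper.prems
    by (auto simp: ins mset_of_remove[of f c] add_proc_mset_of[of f])
  moreover have "f(c := g c) = g"
  proof
    fix d
    show "(f(c := g c)) d = g d"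
      using exec_other_channel[OF block_proper.hyps(5), of d]
        proj_inputs_on[OF block_proper.hyps(1), of d] proj_outputs_on[OF block_proper.hyps(2), of d]
      by auto
  qed
  ultimately show ?case
    using block_proper.IH exec_family[OF block_proper.hyps(5)] block_proper.prems block_proper.hyps(6)
      comp_trans by metis
next
  case (block_improper c ins f \<Phi> g \<Psi>)
  obtain M ins' where ins: "ins = AIn c M # ins'" "inputs_on c ins'"
    using block_improper.hyps(1,2) by (cases ins) auto
  have res: "f c = resolve (f c)"
    using is_initial_resolved[OF block_improper.prems(2)] by (simp add: resolved_def)
  have "focused Sig E IStar (P, \<Phi>) [] (None, \<Psi>)" if "exec f \<Phi> [] g \<Psi>" "f c = resolve P" for f \<Phi> P
  proof -
    have "resolve P = Null" "\<Psi> = \<Phi>" using that block_improper.hyps(4) by auto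
    then show ?thesis by - (rule focused_resolve, simp add: foc_improper)
  qed
  then have "focused Sig E IStar (f c, \<Phi>) (ins @ []) (None, \<Psi>)"
    using exec_inputs_imp_focused[of f \<Phi> ins "[]", OF _ block_improper.hyps(1) res]
      block_improper.hyps(3) by simp
  then have "focused Sig E IPlus (f c, \<Phi>) ins (None, \<Psi>)"
    using focused_IPlus_if_IStar by (simp add: ins)
  from comp_improper[OF this, of "mset_of (f(c := Null))"]
  show ?case
    using block_improper.hyps(3) block_improper.prems
    by (auto simp: ins mset_of_remove[of f c])
qed

lemma compressed_iff_block_exec:
  assumes "family f" "is_initial f"
  shows "(\<exists>\<P>. compressed Sig E (mset_of f, \<Phi>) tr (\<P>, \<Psi>)) \<longleftrightarrow> (\<exists>r. block_exec f \<Phi> tr r \<Psi>)"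
  using compressed_imp_block_exec[OF _ refl assms] block_exec_imp_compressed[OF _ assms]
  by fastforce

section \<open>Inclusion of traces\<close>

definition exec_incl :: "('c \<Rightarrow> ('f, 'n, 'x, 'c) proc) \<Rightarrow> ('f, 'n, 'x, 'w) frame \<Rightarrow>
    ('c \<Rightarrow> ('f, 'n, 'x, 'c) proc) \<Rightarrow> ('f, 'n, 'x, 'w) frame \<Rightarrow> bool" where
  "exec_incl f \<Phi> f' \<Phi>' \<longleftrightarrow> (\<forall>tr g \<Psi>. exec f \<Phi> tr g \<Psi> \<longrightarrow>
    (\<exists>g' \<Psi>'. exec f' \<Phi>' tr g' \<Psi>' \<and> static_equiv Sig E \<Psi> \<Psi>'))"

definition block_incl :: "('c \<Rightarrow> ('f, 'n, 'x, 'c) proc) \<Rightarrow> ('f, 'n, 'x, 'w) frame \<Rightarrow>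
    ('c \<Rightarrow> ('f, 'n, 'x, 'c) proc) \<Rightarrow> ('f, 'n, 'x, 'w) frame \<Rightarrow> bool" where
  "block_incl f \<Phi> f' \<Phi>' \<longleftrightarrow> (\<forall>tr r \<Psi>. block_exec f \<Phi> tr r \<Psi> \<longrightarrow>
    (\<exists>r' \<Psi>'. block_exec f' \<Phi>' tr r' \<Psi>' \<and> static_equiv Sig E \<Psi> \<Psi>'))"

lemma exec_inclD:
  assumes "exec_incl f \<Phi> f' \<Phi>'" "exec f \<Phi> tr g \<Psi>"
  obtains g' \<Psi>' where "exec f' \<Phi>' tr g' \<Psi>'" "static_equiv Sig E \<Psi> \<Psi>'"
  using assms unfolding exec_incl_def by blast

lemma block_inclD:
  assumes "block_incl f \<Phi> f' \<Phi>'" "block_exec f \<Phi> tr r \<Psi>"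
  obtains r' \<Psi>' where "block_exec f' \<Phi>' tr r' \<Psi>'" "static_equiv Sig E \<Psi> \<Psi>'"
  using assms unfolding block_incl_def by blast

section \<open>From concrete to compressed inclusion\<close>

lemma exec_incl_after:
  assumes "exec_incl f \<Phi> f' \<Phi>'" "exec f \<Phi> tr g \<Psi>" "exec f' \<Phi>' tr g' \<Psi>'"
  shows "exec_incl g \<Psi> g' \<Psi>'"
  unfolding exec_incl_def
proof (intro allI impI)
  fix tr' h \<Omega> assume "exec g \<Psi> tr' h \<Omega>"
  with assms(2) have "exec f \<Phi> (tr @ tr') h \<Omega>" unfolding exec_append by blast
  then obtain h' \<Omega>' where h': "exec f' \<Phi>' (tr @ tr') h' \<Omega>'" "static_equiv Sig E \<Omega> \<Omega>'"
    using exec_inclD[OF assms(1)] by blast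
  then obtain g'' \<Psi>'' where "exec f' \<Phi>' tr g'' \<Psi>''" "exec g'' \<Psi>'' tr' h' \<Omega>'"
    unfolding exec_append by blast
  \<comment> \<open>By determinism the intermediate state of the matching execution is the given
    \<open>g'\<close> with frame \<open>\<Psi>'\<close>.\<close>
  with h'(2) show "\<exists>h' \<Omega>'. exec g' \<Psi>' tr' h' \<Omega>' \<and> static_equiv Sig E \<Omega> \<Omega>'"
    using exec_deterministic[OF assms(3)] by blast
qed

lemma is_initial_after_exec:
  assumes "exec f \<Phi> tr g \<Psi>" "is_initial f" "\<And>d. d \<noteq> c \<Longrightarrow> proj d tr = []"
    and "g c = Null \<or> (\<exists>d x P. g c = Inp d x P)"
  shows "is_initial g"
  unfolding is_initial_def
proof
  fix d
  show "g d = Null \<or> (\<exists>d' x P. g d = Inp d' x P)"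
    using assms exec_other_channel[OF assms(1), of d]
    by (cases "d = c") (simp_all add: is_initial_def)
qed

lemma exec_input_terms:
  assumes "exec f \<Phi> tr g \<Psi>" "AIn c M \<in> set tr"
  shows "M \<in> terms Sig (dom \<Psi>)"
  using assms
proof (induction rule: exec.induct)
  case (exec_In f d x P M' \<Phi> tr g \<Psi>)
  have "dom \<Phi> \<subseteq> dom \<Psi>" using exec_In.hyps(3) by (simp add: exec_iff)
  with exec_In show ?case using terms_mono by fastforce
qed simp_all

text \<open>A fresh handle, available because handles are infinite and the frame is finite, would
  make the output executable; the initial \<open>f\<close> could not follow it.\<close>

lemma exec_incl_not_output:
  fixes \<Phi> \<Phi>' :: "('f, 'n, 'x, 'w) frame"
  assumes "exec_incl f' \<Phi>' f \<Phi>" "is_initial f" "finite (dom \<Phi>')" "infinite (UNIV :: 'w set)"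
  shows "f' c \<noteq> Outp c u P"
proof
  assume f': "f' c = Outp c u P"
  obtain w where "w \<notin> dom \<Phi>'" using assms(3,4) ex_new_if_finite by blast
  then have "exec f' \<Phi>' [AOut c w] (f'(c := resolve P)) (\<Phi>'(w \<mapsto> u))"
    by (rule exec_single_Out[of f' c u P, OF f'])
  from exec_inclD[OF assms(1) this] obtain g \<Psi> where "exec f \<Phi> [AOut c w] g \<Psi>" .
  then obtain u' P' where "f c = Outp c u' P'" by blast
  with assms(2) show False unfolding is_initial_def by (metis proc.distinct(5,11))
qed

text \<open>Both inclusions are kept through the induction. After a block \<open>g' c\<close> is
  resolved, hence null, an input or an output; the reverse inclusion into the initial
  \<open>g\<close> excludes the output and, if \<open>g c\<close> is null, the input too.\<close>

lemma exec_incl_imp_block_exec: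
  fixes \<Phi> \<Phi>' \<Psi> :: "('f, 'n, 'x, 'w) frame"
  assumes "block_exec f \<Phi> tr r \<Psi>" "exec_incl f \<Phi> f' \<Phi>'" "exec_incl f' \<Phi>' f \<Phi>"
    and "is_initial f" "is_initial f'" "family f'" "finite (dom \<Phi>')" "infinite (UNIV :: 'w set)"
  shows "\<exists>r' \<Psi>'. block_exec f' \<Phi>' tr r' \<Psi>' \<and> static_equiv Sig E \<Psi> \<Psi>'"
  using assms
proof (induction arbitrary: f' \<Phi>' rule: block_exec.induct)
  case (block_Nil f \<Phi>)
  then obtain g' \<Psi>' where "exec f' \<Phi>' [] g' \<Psi>'" "static_equiv Sig E \<Phi> \<Psi>'"
    using exec_inclD exec_Nil by metis
  then show ?case by (blast intro: block_exec.block_Nil)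
next
  case (block_proper c ins outs f \<Phi> g \<Phi>1 tr r \<Psi>)
  obtain g' \<Phi>1' where g': "exec f' \<Phi>' (ins @ outs) g' \<Phi>1'"
    using exec_inclD[OF block_proper.prems(1) block_proper.hyps(5)] .
  have incl: "exec_incl g \<Phi>1 g' \<Phi>1'" "exec_incl g' \<Phi>1' g \<Phi>1"
    using exec_incl_after block_proper.prems(1,2) block_proper.hyps(5) g' by blast+
  have fam: "family g'" "finite (dom \<Phi>1')" "resolved g'"
    using exec_family[OF g'] exec_dom_finite[OF g'] exec_resolved[OF g'] block_proper.prems
      is_initial_resolved by blast+
  have "g' c \<noteq> Outp c u P" for u P
    by (rule exec_incl_not_output[OF incl(2) block_proper.hyps(6) fam(2) block_proper.prems(7)])
  then have "g' c = Null \<or> (\<exists>d x P. g' c = Inp d x P)"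
    using resolved_cases[OF fam(3,1), of c] by metis
  then have init: "is_initial g'"
    using is_initial_after_exec[OF g' block_proper.prems(4), of c]
      proj_inputs_on[OF block_proper.hyps(1)] proj_outputs_on[OF block_proper.hyps(2)] by simp
  from block_proper.IH[OF incl block_proper.hyps(6) init fam(1,2) block_proper.prems(7)]
  obtain r' \<Psi>' where "block_exec g' \<Phi>1' tr r' \<Psi>'" "static_equiv Sig E \<Psi> \<Psi>'" by blast
  with block_exec.block_proper[OF block_proper.hyps(1-4) g' init] show ?case by blast
next
  case (block_improper c ins f \<Phi> g \<Psi>)
  obtain g' \<Psi>' where g': "exec f' \<Phi>' ins g' \<Psi>'" "static_equiv Sig E \<Psi> \<Psi>'"
    using exec_inclD[OF block_improper.prems(1) block_improper.hyps(3)] .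
  have incl: "exec_incl g' \<Psi>' g \<Psi>"
    using exec_incl_after block_improper.prems(2) block_improper.hyps(3) g'(1) by blast
  have fam: "family g'" "finite (dom \<Psi>')" "resolved g'"
    using exec_family[OF g'(1)] exec_dom_finite[OF g'(1)] exec_resolved[OF g'(1)]
      block_improper.prems is_initial_resolved by blast+
  have "is_initial g"
    using is_initial_after_exec[OF block_improper.hyps(3) block_improper.prems(3), of c]
      proj_inputs_on[OF block_improper.hyps(1)] block_improper.hyps(4) by simp
  then have "g' c \<noteq> Outp c u P" for u P
    by (rule exec_incl_not_output[OF incl _ fam(2) block_improper.prems(7)])
  moreover have "g' c \<noteq> Inp c x P" for x P
  proof
    assume inp: "g' c = Inp c x P"
    \<comment> \<open>An executable input requires a recipe over the current handles; one from the
      block itself is certain to exist.\<close>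
    obtain M where "AIn c M \<in> set ins"
      using block_improper.hyps(1,2) by (cases ins) auto
    note exec_single_In[of g' c x P, OF inp exec_input_terms[OF g'(1) this]]
    from exec_inclD[OF incl this] obtain h \<Omega> where "exec g \<Psi> [AIn c M] h \<Omega>" .
    with block_improper.hyps(4) show False by auto
  qed
  ultimately have "g' c = Null" using resolved_cases[OF fam(3,1), of c] by metis
  with block_exec.block_improper[OF block_improper.hyps(1,2) g'(1)] g'(2) show ?case by blast
qed

section \<open>From compressed to concrete inclusion\<close>

definition complete :: "('c \<Rightarrow> ('f, 'n, 'x, 'c) proc) \<Rightarrow> ('f, 'c, 'w) action list \<Rightarrow> bool" where
  "complete g tr \<longleftrightarrow> is_initial g \<and>
    (\<forall>c. proj c tr = [] \<or> (\<exists>w. last (proj c tr) = AOut c w) \<or> g c = Null)"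

text \<open>Pending outputs are emitted under fresh handles, and a channel waiting for an input
  right after an input reuses the recipe of the latter, which the assumption on \<open>tr\<close>
  keeps available. A channel without actions in \<open>tr\<close> may wait at an input, as there may
  be no recipe for it. The total of \<open>num_actions\<close> decreases.\<close>

lemma complete_extension:
  fixes \<Phi> :: "('f, 'n, 'x, 'w) frame"
  assumes "family f" "resolved f" "finite (dom \<Phi>)" "infinite (UNIV :: 'w set)"
    and "\<And>c M. AIn c M \<in> set tr \<Longrightarrow> M \<in> terms Sig (dom \<Phi>)"
    and "finite S" "\<And>c. c \<notin> S \<Longrightarrow> f c = Null"
  shows "\<exists>ext g \<Psi>. exec f \<Phi> ext g \<Psi> \<and> complete g (tr @ ext)"
  using assms
proof (induction "\<Sum>c\<in>S. num_actions (f c)" arbitrary: f \<Phi> tr rule: less_induct)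
  case less
  have extend: ?case
    if ex: "exec f \<Phi> [a] (f(c := Q)) \<Phi>'" and less: "num_actions Q < num_actions (f c)" for a c Q \<Phi>'
  proof -
    have "f c \<noteq> Null" using less by auto
    then have c: "c \<in> S" using less.prems(7) by blast
    have "(\<Sum>d\<in>S. num_actions ((f(c := Q)) d)) < (\<Sum>d\<in>S. num_actions (f d))"
      using less.prems(6) c less by (intro sum_strict_mono_ex1) auto
    moreover have "M \<in> terms Sig (dom \<Phi>')" if "AIn d M \<in> set (tr @ [a])" for d M
    proof -
      have "dom \<Phi> \<subseteq> dom \<Phi>'" using ex by (simp add: exec_iff)
      from that show ?thesis
        using less.prems(5)[of d M] terms_mono[OF _ \<open>dom \<Phi> \<subseteq> dom \<Phi>'\<close>]
          exec_input_terms[OF ex, of d M] by auto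
    qed
    ultimately have "\<exists>ext g \<Psi>. exec (f(c := Q)) \<Phi>' ext g \<Psi> \<and> complete g ((tr @ [a]) @ ext)"
      using less.prems exec_family[OF ex] exec_resolved[OF ex] exec_dom_finite[OF ex] c
      by (intro less.hyps) auto
    then obtain ext g \<Psi> where "exec (f(c := Q)) \<Phi>' ext g \<Psi>" "complete g (tr @ a # ext)" by auto
    moreover from this(1) ex have "exec f \<Phi> ([a] @ ext) g \<Psi>" unfolding exec_append by blast
    ultimately show ?thesis by auto
  qed
  show ?case
  proof (cases "complete f tr")
    case True
    then show ?thesis by (intro exI[of _ "[]"]) (auto intro: exec_Nil)
  next
    case False
    consider c u P where "f c = Outp c u P"
      | c x P where "f c = Inp c x P" "proj c tr \<noteq> []" "\<nexists>w. last (proj c tr) = AOut c w"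
    proof (cases "is_initial f")
      case True
      then obtain c where c: "proj c tr \<noteq> []" "\<nexists>w. last (proj c tr) = AOut c w" "f c \<noteq> Null"
        using False by (auto simp: complete_def)
      then show ?thesis using that resolved_cases[OF less.prems(2,1), of c] by metis
    next
      case False
      then obtain c where "f c \<noteq> Null" "\<nexists>d x P. f c = Inp d x P" by (auto simp: is_initial_def)
      then show ?thesis using that resolved_cases[OF less.prems(2,1), of c] by metis
    qed
    then show ?thesis
    proof cases
      case (1 c u P)
      obtain w where "w \<notin> dom \<Phi>" using less.prems(3,4) ex_new_if_finite by blast
      from exec_single_Out[of f c u P, OF 1 this] show ?thesis
        by (rule extend) (simp add: 1 num_actions_resolve_le le_imp_less_Suc)
    next
      case (2 c x P)
      have "last (proj c tr) \<in> set (proj c tr)" by (rule last_in_set[OF 2(2)])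
      then have last: "last (proj c tr) \<in> set tr" "action_on c (last (proj c tr))"
        by (simp_all only: set_filter mem_Collect_eq)
      obtain M where "last (proj c tr) = AIn c M"
        using last(2) 2(3) by (cases "last (proj c tr)") auto
      with last(1) less.prems(5) have "M \<in> terms Sig (dom \<Phi>)" by metis
      from exec_single_In[of f c x P, OF 2(1) this] show ?thesis
        by (rule extend)
          (simp add: 2 le_imp_less_Suc[OF order_trans[OF num_actions_resolve_le]])
    qed
  qed
qed

lemma complete_appendD:
  assumes "complete g (tr @ tr')"
  shows "complete g tr'"
  unfolding complete_def
proof (intro conjI allI)
  show "is_initial g" using assms by (simp add: complete_def)
  fix c
  have "proj c (tr @ tr') = [] \<or> (\<exists>w. last (proj c (tr @ tr')) = AOut c w) \<or> g c = Null"
    using assms unfolding complete_def by blast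
  then show "proj c tr' = [] \<or> (\<exists>w. last (proj c tr') = AOut c w) \<or> g c = Null"
    by (cases "proj c tr' = []") auto
qed

lemma complete_cong:
  assumes "complete g tr" "\<And>d. proj d tr = proj d tr'"
  shows "complete g tr'"
  using assms by (simp add: complete_def)

text \<open>Splitting off a proper block shortens the trace and preserves all assumptions for the
  remaining states; completeness is used to see that the state after the block is initial and that
  leftover inputs form improper blocks.\<close>

lemma block_incl_imp_exec_complete:
  assumes "exec f \<Phi> tr g \<Psi>" "complete g tr" "is_initial f" "block_incl f \<Phi> f' \<Phi>'"
  shows "\<exists>g' \<Psi>'. exec f' \<Phi>' tr g' \<Psi>' \<and> static_equiv Sig E \<Psi> \<Psi>'"
  using assms
proof (induction "length tr" arbitrary: tr f \<Phi> f' \<Phi>' rule: less_induct)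
  case less
  \<comment> \<open>The empty trace is a compressed one and already forces the starting frames to be
    equivalent.\<close>
  have se: "static_equiv Sig E \<Phi> \<Phi>'"
    using block_inclD[OF less.prems(4) block_Nil] by (auto elim: block_exec.cases)
  then have dom: "dom \<Phi> = dom \<Phi>'" by (simp add: static_equiv_def)
  have wf: "wf_trace Sig (dom \<Phi>) tr" using less.prems(1) by (simp add: exec_iff)
  show ?case
  proof (cases "outputs tr = {}")
    case False
    from extract_block[OF wf False] obtain c ins outs rest where
      b: "inputs_on c ins" "outputs_on c outs" "outs \<noteq> []" "mset tr = mset ((ins @ outs) @ rest)"
        "\<And>d. proj d tr = proj d ((ins @ outs) @ rest)" "starts_input (proj c rest)"
        "wf_trace Sig (dom \<Phi>) ((ins @ outs) @ rest)" by blast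
    have set: "set tr = set ((ins @ outs) @ rest)" using mset_eq_setD[OF b(4)] .
    have "exec f \<Phi> ((ins @ outs) @ rest) g \<Psi>"
      by (rule exec_reorder[OF less.prems(1) b(7) b(5) set])
    then obtain g1 \<Phi>1 where g1: "exec f \<Phi> (ins @ outs) g1 \<Phi>1" "exec g1 \<Phi>1 rest g \<Psi>"
      unfolding exec_append[of f \<Phi> "ins @ outs" rest] by blast
    \<comment> \<open>If \<open>c\<close> acts no more, its final state is initial by completeness;
      otherwise its next action is an input. In neither case is an output pending.\<close>
    have "g1 c = Null \<or> (\<exists>d x P. g1 c = Inp d x P)"
    proof (cases "proj c rest")
      case Nil
      then have "g c = g1 c" by (rule exec_other_channel[OF g1(2)])
      then show ?thesis using less.prems(2) unfolding complete_def is_initial_def by metis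
    next
      case (Cons a as)
      then obtain d M where "a = AIn d M" using b(6) by (auto simp: starts_input_def)
      moreover have "local_run \<Psi> (proj c rest) (g1 c) = Some (g c)"
        using g1(2) by (simp add: exec_iff)
      ultimately obtain Q where "local_step \<Psi> (AIn d M) (g1 c) = Some Q"
        using Cons by (auto simp: bind_eq_Some_conv)
      then show ?thesis by (auto elim: local_step_InE)
    qed
    then have init: "is_initial g1"
      using is_initial_after_exec[OF g1(1) less.prems(3), of c]
        proj_inputs_on[OF b(1)] proj_outputs_on[OF b(2)] by simp
    have "ins \<noteq> []"
    proof
      assume "ins = []"
      moreover obtain w outs' where "outs = AOut c w # outs'" using b(2,3) by (cases outs) auto
      ultimately obtain u P where "f c = Outp c u P" using g1(1) by auto
      with less.prems(3) show False unfolding is_initial_def by (metis proc.distinct(5,11))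
    qed
    note block = block_proper[OF b(1,2) this b(3) g1(1) init]
    from block_inclD[OF less.prems(4) block[OF block_Nil]] obtain r' \<Psi>1'
      where "block_exec f' \<Phi>' ((ins @ outs) @ []) r' \<Psi>1'" by blast
    from block_exec_properD[OF this b(1-3) starts_input_Nil] obtain g1' \<Phi>1'
      where g1': "exec f' \<Phi>' (ins @ outs) g1' \<Phi>1'" .
    \<comment> \<open>Prefixing the block turns a run from \<open>g1\<close> into one from
      \<open>f\<close>; on the matching side it is stripped again by unique parsing and
      determinism.\<close>
    have incl: "block_incl g1 \<Phi>1 g1' \<Phi>1'"
      unfolding block_incl_def
    proof (intro allI impI)
      fix tr' r \<Omega> assume tr': "block_exec g1 \<Phi>1 tr' r \<Omega>"
      from block_inclD[OF less.prems(4) block[OF tr']] obtain r' \<Omega>'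
        where r': "block_exec f' \<Phi>' ((ins @ outs) @ tr') r' \<Omega>'" "static_equiv Sig E \<Omega> \<Omega>'" .
      from block_exec_properD[OF r'(1) b(1-3) block_exec_starts_input[OF tr']] obtain g2 \<Phi>2
        where "exec f' \<Phi>' (ins @ outs) g2 \<Phi>2" "block_exec g2 \<Phi>2 tr' r' \<Omega>'" .
      with r'(2) show "\<exists>r' \<Omega>'. block_exec g1' \<Phi>1' tr' r' \<Omega>' \<and> static_equiv Sig E \<Omega> \<Omega>'"
        using exec_deterministic[OF g1'] by blast
    qed
    have "complete g rest"
      using complete_appendD complete_cong[OF less.prems(2) b(5)] by blast
    moreover have "length rest < length tr"
      using arg_cong[OF b(4), of size] b(3) by simp
    ultimately obtain g' \<Psi>' where g': "exec g1' \<Phi>1' rest g' \<Psi>'" "static_equiv Sig E \<Psi> \<Psi>'"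
      using less.hyps[OF _ g1(2) _ init incl] by blast
    have "exec f' \<Phi>' ((ins @ outs) @ rest) g' \<Psi>'"
      unfolding exec_append[of f' \<Phi>' "ins @ outs" rest] using g1' g'(1) by blast
    then have "exec f' \<Phi>' tr g' \<Psi>'"
      by (rule exec_reorder) (use wf dom b(5) set in auto)
    with g'(2) show ?thesis by blast
  next
    case True
    have "\<Psi> = \<Phi>"
      using less.prems(1) True by (simp add: exec_iff map_le_antisym map_le_def)
    have ins: "\<exists>d M. a = AIn d M" if "a \<in> set tr" for a
    proof (cases a)
      case Tau
      then show ?thesis using that wf_trace_no_Tau[OF wf] by simp
    next
      case (AOut d w)
      then show ?thesis using that True by (auto simp: outputs_def)
    qed simp
    \<comment> \<open>An active channel has performed inputs only, so by completeness it has
      terminated and its projection alone is an improper block. No frame grows, so the separate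
      matches all read their recipes in \<open>\<Phi>'\<close> and combine by
      \<open>exec_iff\<close>.\<close>
    have "\<exists>P. local_run \<Phi>' (proj c tr) (f' c) = Some P" for c
    proof (cases "proj c tr = []")
      case False
      have on: "inputs_on c (proj c tr)" using ins by (force simp: inputs_on_def)
      have "last (proj c tr) \<noteq> AOut c w" for w
        using on last_in_set[OF False] by (force simp: inputs_on_def)
      then have "g c = Null" using less.prems(2) False by (auto simp: complete_def)
      moreover have "wf_trace Sig (dom \<Phi>) (proj c tr)"
        using wf ins wf_trace_inputs_append[of tr Sig "dom \<Phi>" "[]"]
          wf_trace_inputs_append[of "proj c tr" Sig "dom \<Phi>" "[]"] by auto
      ultimately have "exec f \<Phi> (proj c tr) (f(c := Null)) \<Phi>"
        using less.prems(1) on \<open>\<Psi> = \<Phi>\<close> by (auto simp: exec_iff proj_proj simp del: filter_filter)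
      note block_improper[OF on False this fun_upd_same]
      from block_inclD[OF less.prems(4) this]
      obtain r' \<Psi>' where "block_exec f' \<Phi>' (proj c tr) r' \<Psi>'" .
      then obtain g' where g': "exec f' \<Phi>' (proj c tr) g' \<Psi>'" using block_exec_imp_exec by blast
      then have "\<Psi>' = \<Phi>'" using on by (simp add: exec_iff map_le_antisym map_le_def)
      with g' have "local_run \<Phi>' (proj c (proj c tr)) (f' c) = Some (g' c)"
        unfolding exec_iff by blast
      then show ?thesis by (simp add: proj_proj del: filter_filter)
    qed simp
    then obtain g' where "\<And>c. local_run \<Phi>' (proj c tr) (f' c) = Some (g' c)" by metis
    then have "exec f' \<Phi>' tr g' \<Phi>'" using wf dom True by (simp add: exec_iff)
    with se \<open>\<Psi> = \<Phi>\<close> show ?thesis by blast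
  qed
qed

text \<open>The match of the completed trace passes through a match of \<open>tr\<close>;
  equivalence of the final frames restricts to the frames reached there.\<close>

lemma block_incl_imp_exec_incl:
  fixes \<Phi> \<Phi>' :: "('f, 'n, 'x, 'w) frame"
  assumes "block_incl f \<Phi> f' \<Phi>'" "is_initial f" "family f"
    and "finite (dom \<Phi>)" "infinite (UNIV :: 'w set)"
  shows "exec_incl f \<Phi> f' \<Phi>'"
  unfolding exec_incl_def
proof (intro allI impI)
  fix tr g \<Psi> assume g: "exec f \<Phi> tr g \<Psi>"
  have fam: "family g" "resolved g" "finite (dom \<Psi>)"
    using exec_family[OF g] exec_resolved[OF g] exec_dom_finite[OF g] assms is_initial_resolved
    by blast+
  have fin: "finite {c. g c \<noteq> Null}" using fam(1) by (simp add: family_def)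
  have "\<exists>ext h \<Omega>. exec g \<Psi> ext h \<Omega> \<and> complete h (tr @ ext)"
    by (rule complete_extension[OF fam assms(5) _ fin]) (auto intro: exec_input_terms[OF g])
  then obtain ext h \<Omega> where h: "exec g \<Psi> ext h \<Omega>" "complete h (tr @ ext)" by blast
  have "exec f \<Phi> (tr @ ext) h \<Omega>" using g h(1) unfolding exec_append by blast
  from block_incl_imp_exec_complete[OF this h(2) assms(2,1)]
  obtain h' \<Omega>' where h': "exec f' \<Phi>' (tr @ ext) h' \<Omega>'" "static_equiv Sig E \<Omega> \<Omega>'" by blast
  then obtain g' \<Psi>' where g': "exec f' \<Phi>' tr g' \<Psi>'" "exec g' \<Psi>' ext h' \<Omega>'"
    unfolding exec_append by blast
  have "static_equiv Sig E \<Phi> \<Phi>'"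
    using block_inclD[OF assms(1) block_Nil] by (auto elim: block_exec.cases)
  \<comment> \<open>Both domains consist of the common initial one and \<open>outputs tr\<close>, as
    the restriction of static equivalence requires.\<close>
  then have "dom \<Psi> = dom \<Psi>'"
    using g g'(1) by (simp add: exec_iff static_equiv_def)
  then have "static_equiv Sig E \<Psi> \<Psi>'"
    using static_equiv_map_le[OF h'(2)] h(1) g'(2) by (simp add: exec_iff)
  with g'(1) show "\<exists>g' \<Psi>'. exec f' \<Phi>' tr g' \<Psi>' \<and> static_equiv Sig E \<Psi> \<Psi>'" by blast
qed

section \<open>Trace inclusions of multisets expressed by families\<close>

lemma trace_incl_iff:
  assumes "family f" "resolved f" "family f'" "resolved f'"
  shows "trace_incl Sig E (mset_of f, \<Phi>) (mset_of f', \<Phi>') \<longleftrightarrow> exec_incl f \<Phi> f' \<Phi>'"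
proof -
  have "trace_incl Sig E (mset_of f, \<Phi>) (mset_of f', \<Phi>') \<longleftrightarrow>
    (\<forall>tr \<Psi>. (\<exists>\<P>. weak_steps Sig E (mset_of f, \<Phi>) tr (\<P>, \<Psi>)) \<longrightarrow>
      (\<exists>\<Psi>'. (\<exists>\<P>. weak_steps Sig E (mset_of f', \<Phi>') tr (\<P>, \<Psi>')) \<and> static_equiv Sig E \<Psi> \<Psi>'))"
    unfolding trace_incl_def by blast
  also have "\<dots> \<longleftrightarrow> (\<forall>tr \<Psi>. (\<exists>g. exec f \<Phi> tr g \<Psi>) \<longrightarrow>
      (\<exists>\<Psi>'. (\<exists>g. exec f' \<Phi>' tr g \<Psi>') \<and> static_equiv Sig E \<Psi> \<Psi>'))"
    unfolding weak_steps_iff_exec[OF assms(1,2)] weak_steps_iff_exec[OF assms(3,4)] ..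
  also have "\<dots> \<longleftrightarrow> exec_incl f \<Phi> f' \<Phi>'"
    unfolding exec_incl_def by blast
  finally show ?thesis .
qed

lemma comp_trace_incl_iff:
  assumes "family f" "is_initial f" "family f'" "is_initial f'"
  shows "comp_trace_incl Sig E (mset_of f, \<Phi>) (mset_of f', \<Phi>') \<longleftrightarrow> block_incl f \<Phi> f' \<Phi>'"
proof -
  have "comp_trace_incl Sig E (mset_of f, \<Phi>) (mset_of f', \<Phi>') \<longleftrightarrow>
    (\<forall>tr \<Psi>. (\<exists>\<P>. compressed Sig E (mset_of f, \<Phi>) tr (\<P>, \<Psi>)) \<longrightarrow>
      (\<exists>\<Psi>'. (\<exists>\<P>. compressed Sig E (mset_of f', \<Phi>') tr (\<P>, \<Psi>')) \<and> static_equiv Sig E \<Psi> \<Psi>'))"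
    unfolding comp_trace_incl_def by blast
  also have "\<dots> \<longleftrightarrow> (\<forall>tr \<Psi>. (\<exists>r. block_exec f \<Phi> tr r \<Psi>) \<longrightarrow>
      (\<exists>\<Psi>'. (\<exists>r. block_exec f' \<Phi>' tr r \<Psi>') \<and> static_equiv Sig E \<Psi> \<Psi>'))"
    unfolding compressed_iff_block_exec[OF assms(1,2)] compressed_iff_block_exec[OF assms(3,4)] ..
  also have "\<dots> \<longleftrightarrow> block_incl f \<Phi> f' \<Phi>'"
    unfolding block_incl_def by blast
  finally show ?thesis .
qed

end

theorem theorem1:
  fixes Sig :: "('f \<times> nat) set"
    and E :: "(('f, 'n, 'x) msg \<times> ('f, 'n, 'x) msg) set"
    and A B :: "('f, 'n, 'x, 'c, 'w) ext_simple"
  assumes "infinite (UNIV :: 'x set)" and "infinite (UNIV :: 'w set)"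
    and "finite Sig" and "E \<subseteq> messages Sig \<times> messages Sig"
    and "ext_simple_process Sig A" and "initial A"
    and "ext_simple_process Sig B" and "initial B"
  shows "trace_equiv Sig E A B \<longleftrightarrow> comp_trace_equiv Sig E A B"
proof -
  interpret semantics Sig E .
  obtain f \<Phi> where f: "A = (mset_of f, \<Phi>)" "family f" "is_initial f" "finite (dom \<Phi>)"
    using ext_simple_process_obtain_family[OF assms(5,6)] .
  obtain g \<Psi> where g: "B = (mset_of g, \<Psi>)" "family g" "is_initial g" "finite (dom \<Psi>)"
    using ext_simple_process_obtain_family[OF assms(7,8)] .
  note resolved = is_initial_resolved[OF f(3)] is_initial_resolved[OF g(3)]
  have "trace_equiv Sig E A B \<longleftrightarrow> exec_incl f \<Phi> g \<Psi> \<and> exec_incl g \<Psi> f \<Phi>"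
    using f(1,2) g(1,2) resolved by (simp add: trace_equiv_def trace_incl_iff)
  also have "\<dots> \<longleftrightarrow> block_incl f \<Phi> g \<Psi> \<and> block_incl g \<Psi> f \<Phi>"
  proof
    assume incl: "exec_incl f \<Phi> g \<Psi> \<and> exec_incl g \<Psi> f \<Phi>"
    show "block_incl f \<Phi> g \<Psi> \<and> block_incl g \<Psi> f \<Phi>"
      unfolding block_incl_def
      using exec_incl_imp_block_exec[of f \<Phi> _ _ _ g \<Psi>] exec_incl_imp_block_exec[of g \<Psi> _ _ _ f \<Phi>]
        incl f g assms(2) by blast
  next
    assume "block_incl f \<Phi> g \<Psi> \<and> block_incl g \<Psi> f \<Phi>"
    then show "exec_incl f \<Phi> g \<Psi> \<and> exec_incl g \<Psi> f \<Phi>"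
      using block_incl_imp_exec_incl f g assms(2) by blast
  qed
  also have "\<dots> \<longleftrightarrow> comp_trace_equiv Sig E A B"
    using f(1-3) g(1-3) by (simp add: comp_trace_equiv_def comp_trace_incl_iff)
  finally show ?thesis .
qed

end
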